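(* Let $\mathcal{H}$ be a real Hilbert space, let $M\colon\mathcal{H}\to\mathcal{H}$ be a bounded linear self-adjoint strongly positive operator, and let $\beta>0$. Suppose that $A\colon\mathcal{H}\to 2^{\mathcal{H}}$ is maximally monotone, that $C\colon\mathcal{H}\to\mathcal{H}$ is $\frac1\beta$-cocoercive with respect to $\|\cdot\|_M$, and that $\operatorname{zer}(A+C)=\{x\in\mathcal{H}: 0\in Ax+Cx\}$ is nonempty. Let $\epsilon\in\left(0,\min\left(1,\tfrac{4}{3+\beta}\right)\right)$ and let $(\zeta_n)_{n\in\mathbb{N}}$, $(\gamma_n)_{n\in\mathbb{N}}$, $(\lambda_n)_{n\in\mathbb{N}}$ be real sequences such that, for all $n\in\mathbb{N}$, $0\le\zeta_n\le 1-\epsilon$, $\epsilon\le\gamma_n\le\frac{4-3\epsilon}{\beta}$, and $\epsilon\le\lambda_n\le 2-\frac{\gamma_n\beta}{2}-\frac{\epsilon}{2}$. Suppose further that $A+C$ is $M$-metrically subregular at every $x^\star\in\operatorname{zer}(A+C)$ for $0$, and that either $\mathcal{H}$ is finite-dimensional, or, for every $x^\star\in\operatorname{zer}(A+C)$, the neighborhood $\mathcal{U}$ of $x^\star$ in the definition of $M$-metric subregularity can be taken to be the whole space $\mathcal{H}$. Let $(x_n)_{n\in\mathbb{N}}$ and $(\ell_n^2)_{n\in\mathbb{N}}$ be generated by the forward--backward algorithm with deviations described in the context. Then there exists $0\le q<1$ such that the following hold. (i) There exists $0<\delta<1$ such that, for all $n\ge1$, $$\operatorname{dist}_M^2(x_{n+1},\operatorname{zer}(A+C))+(1-\delta)\ell_n^2\le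 q\left(\operatorname{dist}_M^2(x_n,\operatorname{zer}(A+C))+(1-\delta)\ell_{n-1}^2\right).$$ (ii) There exist $x^*\in\operatorname{zer}(A+C)$ and $c>0$ such that $\|x_n-x^*\|^2\le cq^n$ for all $n\ge1$. Hence $x_n\to x^*$ strongly, even if $\mathcal{H}$ is infinite-dimensional.
   Context: $\mathbb{N}=\{0,1,2,\dots\}$. A bounded self-adjoint linear operator $M$ on $\mathcal{H}$ is strongly positive if there is $c>0$ with $\langle x,Mx\rangle\ge c\|x\|^2$ for all $x$; then $M^{-1}$ exists and has the same properties. $\langle x,y\rangle_M=\langle x,My\rangle$, $\|x\|_M=\sqrt{\langle x,Mx\rangle}$, and similarly $\|x\|_{M^{-1}}=\sqrt{\langle x,M^{-1}x\rangle}$. $C$ is $\frac1\beta$-cocoercive with respect to $\|\cdot\|_M$ if $\langle Cx-Cy,x-y\rangle\ge\frac1\beta\|Cx-Cy\|_{M^{-1}}^2$ for all $x,y\in\mathcal{H}$. For $S\subset\mathcal{H}$, $\operatorname{dist}_M(x,S)=\inf_{y\in S}\|x-y\|_M$ (with value $+\infty$ if $S=\emptyset$), likewise $\operatorname{dist}_{M^{-1}}$; $\operatorname{dist}_M^2$ denotes the square of $\operatorname{dist}_M$. $M$-metric subregularity: a set-valued mapping $T\colon\mathcal{H}\to2^{\mathcal{H}}$ is $M$-metrically subregular at $\bar x$ for $\bar y$ if $\bar y\in T(\bar x)$ and there exist $\kappa\ge0$ and neighborhoods $\mathcal{U}$ of $\bar x$ and $\mathcal{V}$ of $\bar y$ such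 that $\operatorname{dist}_M(x,T^{-1}(\bar y))\le\kappa\operatorname{dist}_{M^{-1}}(\bar y,T(x)\cap\mathcal{V})$ for all $x\in\mathcal{U}$. Algorithm (forward--backward splitting with deviations). Given $x_0\in\mathcal{H}$, set $u_0=v_0=0$. For $n=0,1,2,\dots$: $$y_n=x_n+u_n,$$ $$z_n=x_n+\frac{(1-\lambda_n)\gamma_n\beta}{2-\lambda_n\gamma_n\beta}u_n+v_n,$$ $$p_n=(M+\gamma_nA)^{-1}(Mz_n-\gamma_nCy_n),$$ $$x_{n+1}=x_n+\lambda_n(p_n-z_n),$$ and then $u_{n+1},v_{n+1}\in\mathcal{H}$ are chosen arbitrarily subject to $$\frac{\lambda_{n+1}\gamma_{n+1}\beta}{2-\lambda_{n+1}\gamma_{n+1}\beta}\|u_{n+1}\|_M^2+\frac{\lambda_{n+1}(2-\lambda_{n+1}\gamma_{n+1}\beta)}{4-2\lambda_{n+1}-\gamma_{n+1}\beta}\|v_{n+1}\|_M^2\le\zeta_n\ell_n^2,$$ where $$\ell_n^2=\frac{\lambda_n(4-2\lambda_n-\gamma_n\beta)}{2}\left\|p_n-x_n+\frac{\lambda_n\gamma_n\beta}{2-\lambda_n\gamma_n\beta}u_n-\frac{2(1-\lambda_n)}{4-2\lambda_n-\gamma_n\beta}v_n\right\|_M^2.$$ (The parameter conditions guarantee $2-\lambda_n\gamma_n\beta>0$ and $4-2\lambda_n-\gamma_n\beta>0$ for all $n$.) *)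

theory Defs
  imports "HOL-Analysis.Analysis"
begin

text \<open>Real Hilbert spaces are types of sort \<open>{real_inner, complete_space}\<close>; set-valued mappings
  on such a space have type \<open>'a \<Rightarrow> 'a set\<close>.\<close>

definition self_adjoint :: "('a::real_inner \<Rightarrow> 'a) \<Rightarrow> bool" where
  "self_adjoint M \<longleftrightarrow> (\<forall>x y. inner (M x) y = inner x (M y))"

definition strongly_positive :: "('a::real_inner \<Rightarrow> 'a) \<Rightarrow> bool" where
  "strongly_positive M \<longleftrightarrow> (\<exists>c>0. \<forall>x. inner x (M x) \<ge> c * (norm x)\<^sup>2)"

definition norm_wrt :: "('a::real_inner \<Rightarrow> 'a) \<Rightarrow> 'a \<Rightarrow> real" where
  "norm_wrt M x = sqrt (inner x (M x))"

text \<open>The infimum is taken in \<^typ>\<open>ereal\<close>, so that the distance to the empty set is \<open>\<infinity>\<close>.\<close>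

definition dist_wrt :: "('a::real_inner \<Rightarrow> 'a) \<Rightarrow> 'a \<Rightarrow> 'a set \<Rightarrow> ereal" where
  "dist_wrt M x S = (INF y\<in>S. ereal (norm_wrt M (x - y)))"

definition cocoercive_wrt :: "('a::real_inner \<Rightarrow> 'a) \<Rightarrow> real \<Rightarrow> ('a \<Rightarrow> 'a) \<Rightarrow> bool" where
  "cocoercive_wrt M \<alpha> C \<longleftrightarrow>
    (\<forall>x y. inner (C x - C y) (x - y) \<ge> \<alpha> * (norm_wrt (inv M) (C x - C y))\<^sup>2)"

definition monotone_mapping :: "('a::real_inner \<Rightarrow> 'a set) \<Rightarrow> bool" where
  "monotone_mapping A \<longleftrightarrow> (\<forall>x y. \<forall>a\<in>A x. \<forall>b\<in>A y. inner (a - b) (x - y) \<ge> 0)"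

definition maximally_monotone :: "('a::real_inner \<Rightarrow> 'a set) \<Rightarrow> bool" where
  "maximally_monotone A \<longleftrightarrow> monotone_mapping A \<and>
    (\<forall>B. monotone_mapping B \<and> (\<forall>x. A x \<subseteq> B x) \<longrightarrow> B = A)"

definition sum_mapping :: "('a::real_vector \<Rightarrow> 'a set) \<Rightarrow> ('a \<Rightarrow> 'a) \<Rightarrow> 'a \<Rightarrow> 'a set" where
  "sum_mapping A C x = {a + C x |a. a \<in> A x}"

definition scale_mapping :: "real \<Rightarrow> ('a::real_vector \<Rightarrow> 'a set) \<Rightarrow> 'a \<Rightarrow> 'a set" where
  "scale_mapping \<gamma> A x = {\<gamma> *\<^sub>R a |a. a \<in> A x}"

definition inverse_mapping :: "('a \<Rightarrow> 'b set) \<Rightarrow> 'b \<Rightarrow> 'a set" where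
  "inverse_mapping T y = {x. y \<in> T x}"

definition zer :: "('a::real_vector \<Rightarrow> 'a set) \<Rightarrow> 'a set" where
  "zer T = {x. 0 \<in> T x}"

text \<open>Metric subregularity with a prescribed neighborhood \<open>U\<close> of \<open>x0\<close>. The convention
  \<open>0 * \<infinity> = 0\<close> of \<^typ>\<open>ereal\<close> is harmless: whenever \<open>\<kappa> = 0\<close> is admissible, under either
  convention, so is \<open>\<kappa> = 1\<close>.\<close>

definition metrically_subregular_on ::
    "('a::real_inner \<Rightarrow> 'a) \<Rightarrow> ('a \<Rightarrow> 'a set) \<Rightarrow> 'a \<Rightarrow> 'a \<Rightarrow> 'a set \<Rightarrow> bool" where
  "metrically_subregular_on M T x0 y0 U \<longleftrightarrow> y0 \<in> T x0 \<and> x0 \<in> interior U \<and>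
    (\<exists>\<kappa>\<ge>0. \<exists>V. y0 \<in> interior V \<and>
      (\<forall>x\<in>U. dist_wrt M x (inverse_mapping T y0)
              \<le> ereal \<kappa> * dist_wrt (inv M) y0 (T x \<inter> V)))"

definition metrically_subregular ::
    "('a::real_inner \<Rightarrow> 'a) \<Rightarrow> ('a \<Rightarrow> 'a set) \<Rightarrow> 'a \<Rightarrow> 'a \<Rightarrow> bool" where
  "metrically_subregular M T x0 y0 \<longleftrightarrow> (\<exists>U. metrically_subregular_on M T x0 y0 U)"

text \<open>Runs of forward--backward splitting with deviations, as a relation because \<open>u\<close> and \<open>v\<close> may be
  chosen freely subject to the norm condition. Here \<open>L n\<close> is \<open>\<ell>\<^sub>n\<^sup>2\<close>. For maximally monotone
  \<open>A\<close>, strongly positive \<open>M\<close> and positive step size, the set \<open>(M + \<gamma> A)\<^sup>-\<^sup>1 w\<close> is a singleton, so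
  membership of \<open>p n\<close> in it is the equation defining \<open>p n\<close>.\<close>

definition fb_deviations ::
    "('a::real_inner \<Rightarrow> 'a) \<Rightarrow> ('a \<Rightarrow> 'a set) \<Rightarrow> ('a \<Rightarrow> 'a) \<Rightarrow> real \<Rightarrow>
     (nat \<Rightarrow> real) \<Rightarrow> (nat \<Rightarrow> real) \<Rightarrow> (nat \<Rightarrow> real) \<Rightarrow>
     (nat \<Rightarrow> 'a) \<Rightarrow> (nat \<Rightarrow> 'a) \<Rightarrow> (nat \<Rightarrow> 'a) \<Rightarrow> (nat \<Rightarrow> 'a) \<Rightarrow> (nat \<Rightarrow> 'a) \<Rightarrow> (nat \<Rightarrow> 'a) \<Rightarrow>
     (nat \<Rightarrow> real) \<Rightarrow> bool" where
  "fb_deviations M A C \<beta> \<zeta> \<gamma> lam x u v y z p L \<longleftrightarrow>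
    u 0 = 0 \<and> v 0 = 0 \<and>
    (\<forall>n. y n = x n + u n) \<and>
    (\<forall>n. z n = x n + ((1 - lam n) * \<gamma> n * \<beta> / (2 - lam n * \<gamma> n * \<beta>)) *\<^sub>R u n + v n) \<and>
    (\<forall>n. p n \<in> inverse_mapping (sum_mapping (scale_mapping (\<gamma> n) A) M)
                 (M (z n) - \<gamma> n *\<^sub>R C (y n))) \<and>
    (\<forall>n. x (Suc n) = x n + lam n *\<^sub>R (p n - z n)) \<and>
    (\<forall>n. L n = lam n * (4 - 2 * lam n - \<gamma> n * \<beta>) / 2 *
        (norm_wrt M (p n - x n + (lam n * \<gamma> n * \<beta> / (2 - lam n * \<gamma> n * \<beta>)) *\<^sub>R u n
           - (2 * (1 - lam n) / (4 - 2 * lam n - \<gamma> n * \<beta>)) *\<^sub>R v n))\<^sup>2) \<and>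
    (\<forall>n. lam (Suc n) * \<gamma> (Suc n) * \<beta> / (2 - lam (Suc n) * \<gamma> (Suc n) * \<beta>)
            * (norm_wrt M (u (Suc n)))\<^sup>2
        + lam (Suc n) * (2 - lam (Suc n) * \<gamma> (Suc n) * \<beta>)
            / (4 - 2 * lam (Suc n) - \<gamma> (Suc n) * \<beta>)
            * (norm_wrt M (v (Suc n)))\<^sup>2
        \<le> \<zeta> n * L n)"

end

theory Submission
  imports Defs
begin

text \<open>Write \<open>Z\<close> for the set of zeros. Monotonicity, cocoercivity and the identity
  \<open>deviation_identity\<close> give, for every \<open>xs \<in> Z\<close>, the descent
  \<open>\<parallel>x\<^sub>n\<^sub>+\<^sub>1 - xs\<parallel>\<^sup>2 + L\<^sub>n \<le> \<parallel>x\<^sub>n - xs\<parallel>\<^sup>2 + (1 - \<epsilon>) L\<^sub>n\<^sub>-\<^sub>1\<close> in the norm of \<open>M\<close>, hence the same with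
  \<open>dist(x\<^sub>n, Z)\<^sup>2\<close>. The increments and an element of \<open>(A + C) p\<^sub>n\<close> are bounded by a multiple of
  \<open>S = sqrt L\<^sub>n + sqrt L\<^sub>n\<^sub>-\<^sub>1\<close>, which tends to 0, so metric subregularity eventually gives
  \<open>dist(x\<^sub>n, Z)\<^sup>2 \<le> K (L\<^sub>n + L\<^sub>n\<^sub>-\<^sub>1)\<close>. Feeding a small multiple of this error bound into the
  descent makes \<open>dist(x\<^sub>n, Z)\<^sup>2 + (1 - \<delta>) L\<^sub>n\<^sub>-\<^sub>1\<close> contract; the finitely many early steps contract
  because no decrease forces \<open>L\<^sub>n = L\<^sub>n\<^sub>-\<^sub>1 = 0\<close> and then \<open>x\<^sub>n \<in> Z\<close>. Finally the increments of
  \<open>x\<close> are dominated by a geometric sequence with ratio \<open>sqrt q\<close>. All estimates are carried out in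
  the inner product of \<open>M\<close>, with \<open>C\<close> replaced by \<open>G = M\<^sup>-\<^sup>1 C\<close>.\<close>

section \<open>The geometry of \<open>M\<close>: inner product, norm and invertibility\<close>

locale strongly_positive_operator =
  fixes M :: "'a::{real_inner, complete_space} \<Rightarrow> 'a"
  assumes bounded_linear_M: "bounded_linear M"
    and self_adjoint_M: "self_adjoint M"
    and strongly_positive_M: "strongly_positive M"
begin

sublocale M: bounded_linear M
  by (rule bounded_linear_M)

definition ip :: "'a \<Rightarrow> 'a \<Rightarrow> real" where
  "ip x y = inner x (M y)"

sublocale ip: bounded_bilinear ip
  unfolding ip_def[abs_def]
  by (rule bounded_bilinear.comp[OF bounded_bilinear_inner bounded_linear_ident bounded_linear_M])

abbreviation nm :: "'a \<Rightarrow> real" where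
  "nm \<equiv> norm_wrt M"

lemma ip_commute: "ip x y = ip y x"
  using self_adjoint_M by (simp add: ip_def self_adjoint_def inner_commute)

lemma coercive: obtains c where "c > 0" "\<And>x. c * (norm x)\<^sup>2 \<le> ip x x"
  using strongly_positive_M by (auto simp: strongly_positive_def ip_def)

lemma ip_self_nonneg: "0 \<le> ip x x"
  by (rule coercive) (meson order_trans mult_nonneg_nonneg less_imp_le zero_le_power2)

lemma nm_sq: "(nm x)\<^sup>2 = ip x x"
  using ip_self_nonneg by (simp add: norm_wrt_def ip_def)

lemma nm_nonneg [simp]: "0 \<le> nm x"
  using ip_self_nonneg by (simp add: norm_wrt_def ip_def)

text \<open>Cauchy-Schwarz: the square of \<open>nm y *\<^sub>R x - nm x *\<^sub>R y\<close> is
  nonnegative, and its expansion carries the factor \<open>nm x * nm y\<close>. A nonzero factor is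
  cancelled; a zero factor makes one of the vectors vanish by coercivity.\<close>

lemma ip_le_nm: "ip x y \<le> nm x * nm y"
proof -
  have "0 \<le> ip (nm y *\<^sub>R x - nm x *\<^sub>R y) (nm y *\<^sub>R x - nm x *\<^sub>R y)"
    by (rule ip_self_nonneg)
  also have "\<dots> = 2 * (nm x * nm y)\<^sup>2 - 2 * (nm x * nm y) * ip x y"
    by (simp add: ip.diff_left ip.diff_right ip.scaleR_left ip.scaleR_right algebra_simps
        power_mult_distrib nm_sq ip_commute[of y x]) (simp add: power2_eq_square nm_sq[symmetric])
  finally have *: "(nm x * nm y) * ip x y \<le> (nm x * nm y) * (nm x * nm y)"
    by (simp add: power2_eq_square)
  show ?thesis
  proof (cases "nm x * nm y = 0")
    case False
    then show ?thesis using * by (simp add: mult_le_cancel_left order.strict_iff_order)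
  next
    case True
    obtain c where c: "c > 0" "\<And>x. c * (norm x)\<^sup>2 \<le> ip x x" by (rule coercive) blast
    have "w = 0" if "nm w = 0" for w
    proof -
      have "c * (norm w)\<^sup>2 \<le> 0" using c(2)[of w] nm_sq[of w] that by simp
      then show ?thesis using c(1) by (simp add: mult_le_0_iff)
    qed
    then have "x = 0 \<or> y = 0" using True by auto
    then show ?thesis by (auto simp: ip.zero_left ip.zero_right)
  qed
qed

lemma nm_triangle: "nm (x + y) \<le> nm x + nm y"
proof (rule power2_le_imp_le)
  show "(nm (x + y))\<^sup>2 \<le> (nm x + nm y)\<^sup>2"
    using ip_le_nm[of x y] ip_commute[of x y] nm_sq[of x] nm_sq[of y]
    by (simp add: nm_sq ip.add_left ip.add_right power2_sum)
qed simp

lemma nm_scaleR: "nm (a *\<^sub>R x) = \<bar>a\<bar> * nm x"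
proof (rule power2_eq_imp_eq)
  show "(nm (a *\<^sub>R x))\<^sup>2 = (\<bar>a\<bar> * nm x)\<^sup>2"
    by (simp add: nm_sq ip.scaleR_left ip.scaleR_right power_mult_distrib) (simp add: power2_eq_square)
qed simp_all

lemma nm_uminus [simp]: "nm (- x) = nm x"
  using nm_scaleR[of "-1" x] by simp

lemma nm_diff_triangle: "nm (x - y) \<le> nm x + nm y"
  using nm_triangle[of x "- y"] by simp

lemma nm_minus_commute: "nm (x - y) = nm (y - x)"
  by (metis minus_diff_eq nm_uminus)

lemma norm_le_nm: obtains c where "c > 0" "\<And>x. norm x \<le> c * nm x"
proof (rule coercive)
  fix c assume c: "c > 0" "\<And>x. c * (norm x)\<^sup>2 \<le> ip x x"
  have "norm x \<le> (1 / sqrt c) * nm x" for x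
  proof (rule power2_le_imp_le)
    show "(norm x)\<^sup>2 \<le> (1 / sqrt c * nm x)\<^sup>2"
      using c(1) c(2)[of x] by (simp add: power_mult_distrib nm_sq power_divide field_simps)
  qed (use c in simp)
  then show thesis using c(1) by (intro that[of "1 / sqrt c"]) auto
qed

text \<open>The Lax-Milgram argument: \<open>M x = b\<close> says that \<open>x\<close> is a fixed
  point of the map sending \<open>x\<close> to \<open>x - t *\<^sub>R (M x - b)\<close>, and
  boundedness together with coercivity makes this map a contraction for a suitable
  \<open>t\<close>.\<close>

lemma M_surj: "surj M"
proof -
  obtain c where c: "c > 0" "\<And>x. c * (norm x)\<^sup>2 \<le> ip x x" by (rule coercive) blast
  obtain K where K: "K > 0" "\<And>x. norm (M x) \<le> norm x * K"
    using M.pos_bounded by blast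
  \<comment> \<open>This \<open>t\<close> minimises
    \<open>1 - 2 * t * c + t\<^sup>2 * K\<^sup>2\<close>, the factor that bounds the squared
    contraction constant.\<close>
  define t where "t = c / K\<^sup>2"
  have t: "0 \<le> t" using c(1) by (simp add: t_def)
  \<comment> \<open>In the zero space \<open>c\<close> and \<open>K\<close> are unrelated and the
    difference can be negative; the maximum covers that case.\<close>
  define k where "k = sqrt (max 0 (1 - c\<^sup>2 / K\<^sup>2))"
  have k: "0 \<le> k" "k < 1" using c(1) K(1) by (auto simp: k_def)
  have contr: "norm (x - t *\<^sub>R M x) \<le> k * norm x" for x
  proof (rule power2_le_imp_le)
    have "(norm (x - t *\<^sub>R M x))\<^sup>2 = (norm x)\<^sup>2 - 2 * t * ip x x + t\<^sup>2 * (norm (M x))\<^sup>2"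
      by (simp add: power2_norm_eq_inner inner_diff_left inner_diff_right ip_def
          inner_commute[of "M x" x]) (simp add: power2_eq_square algebra_simps)
    also have "\<dots> \<le> (norm x)\<^sup>2 - 2 * t * (c * (norm x)\<^sup>2) + t\<^sup>2 * (norm x * K)\<^sup>2"
      using t by (intro add_mono diff_mono mult_left_mono power_mono K(2) c(2)) auto
    also have "\<dots> = (1 - c\<^sup>2 / K\<^sup>2) * (norm x)\<^sup>2"
      using K(1) by (simp add: t_def field_simps power2_eq_square)
    also have "\<dots> \<le> (k * norm x)\<^sup>2"
      by (auto simp: k_def power_mult_distrib intro!: mult_right_mono)
    finally show "(norm (x - t *\<^sub>R M x))\<^sup>2 \<le> (k * norm x)\<^sup>2" .
  qed (use k in simp)
  have "\<exists>x. M x = b" for b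
  proof -
    have "\<exists>!x. x - t *\<^sub>R (M x - b) = x"
    proof (rule banach_fix_type[OF k], intro allI)
      fix x y
      show "dist (x - t *\<^sub>R (M x - b)) (y - t *\<^sub>R (M y - b)) \<le> k * dist x y"
        using contr[of "x - y"] by (simp add: dist_norm M.diff algebra_simps)
    qed
    then obtain x where "x - t *\<^sub>R (M x - b) = x" by blast
    then have "M x = b" using c(1) K(1) by (simp add: t_def algebra_simps)
    then show ?thesis ..
  qed
  then show ?thesis by (metis surjI someI_ex)
qed

lemma M_inj: "inj M"
proof (rule injI)
  fix x y assume "M x = M y"
  then have "ip (x - y) (x - y) = 0" by (simp add: ip_def M.diff)
  then have "nm (x - y) = 0" using nm_sq[of "x - y"] by simp
  then show "x = y" by (metis norm_le_nm mult_zero_right norm_le_zero_iff right_minus_eq)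
qed

lemma M_inv [simp]: "M (inv M x) = x" "inv M (M x) = x"
  by (simp_all add: M_surj surj_f_inv_f M_inj inv_f_f)

lemma inner_eq_ip: "inner w x = ip (inv M w) x"
  using ip_commute[of "inv M w" x] by (simp add: ip_def inner_commute)

lemma inv_M_diff: "inv M (x - y) = inv M x - inv M y"
  by (metis M_inv M.diff)

lemma norm_wrt_inv: "norm_wrt (inv M) w = nm (inv M w)"
  by (simp add: norm_wrt_def inner_commute)

end

section \<open>Sequences: subsequences in finite dimension, a contraction principle, geometric
  increments\<close>

lemma bounded_coords_convergent_subseq:
  fixes g :: "'b \<Rightarrow> nat \<Rightarrow> real"
  assumes "finite E" and "\<And>b. b \<in> E \<Longrightarrow> bounded (range (g b))"
  shows "\<exists>r. strict_mono (r :: nat \<Rightarrow> nat) \<and> (\<forall>b\<in>E. convergent (g b \<circ> r))"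
  using assms
proof (induction E)
  case empty
  show ?case using strict_mono_id by blast
next
  case (insert a E)
  then obtain r where r: "strict_mono (r :: nat \<Rightarrow> nat)" "\<forall>b\<in>E. convergent (g b \<circ> r)"
    by blast
  have "bounded (range (g a \<circ> r))"
    by (rule bounded_subset[OF insert.prems[of a]]) auto
  then obtain l s where s: "strict_mono (s :: nat \<Rightarrow> nat)" "(g a \<circ> r \<circ> s) \<longlonglongrightarrow> l"
    using bounded_imp_convergent_subsequence by blast
  have "convergent (g b \<circ> (r \<circ> s))" if "b \<in> insert a E" for b
  proof (cases "b = a")
    case True
    then show ?thesis using s(2) by (auto simp: o_assoc convergent_def)
  next
    case False
    then show ?thesis using that r(2) s(1) by (auto simp: o_assoc intro: convergent_subseq_convergent)
  qed
  then show ?case using strict_mono_o[OF r(1) s(1)] by blast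
qed

text \<open>The type is a general inner product space, so finite dimension is expressed by a finite
  spanning set. Gram-Schmidt replaces it by an orthogonal set \<open>E\<close>; along a common
  subsequence all coefficients with respect to \<open>E\<close> converge, and so do the
  vectors.\<close>

lemma bounded_seq_convergent_subseq:
  fixes f :: "nat \<Rightarrow> 'a::real_inner" and B :: "'a set"
  assumes B: "finite B" "span B = UNIV" and bounded: "bounded (range f)"
  obtains l r where "strict_mono (r :: nat \<Rightarrow> nat)" "(f \<circ> r) \<longlonglongrightarrow> l"
proof -
  obtain E :: "'a set" where E: "finite E" "span E = UNIV" "pairwise orthogonal E"
    using basis_orthogonal[OF B(1)] B(2) by metis
  \<comment> \<open>The set \<open>E\<close> may contain 0; its term vanishes, so the orthogonal
    expansion remains valid.\<close>
  have expand: "(\<Sum>b\<in>E. (inner b x / inner b b) *\<^sub>R b) = x" for x :: 'a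
  proof -
    define w where "w = x - (\<Sum>b\<in>E. (inner b x / inner b b) *\<^sub>R b)"
    have "orthogonal b w" if "b \<in> E" for b
    proof -
      have "inner b (\<Sum>a\<in>E. (inner a x / inner a a) *\<^sub>R a)
          = (\<Sum>a\<in>E. if a = b then inner b x else 0)"
        unfolding inner_sum_right
        using E(3) that by (intro sum.cong) (auto simp: pairwise_def orthogonal_def)
      then show ?thesis
        using E(1) that by (simp add: w_def orthogonal_def inner_diff_right)
    qed
    then have "orthogonal w w"
      using orthogonal_to_span[of w E w] E(2) by (simp add: orthogonal_commute)
    then show ?thesis by (simp add: w_def orthogonal_def)
  qed
  have "bounded (range (\<lambda>n. inner b (f n)))" for b
    using bounded_linear_image[OF bounded bounded_linear_inner_right[of b]]
    by (simp add: image_image)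
  then obtain r where r: "strict_mono (r :: nat \<Rightarrow> nat)"
      "\<forall>b\<in>E. convergent ((\<lambda>n. inner b (f n)) \<circ> r)"
    using bounded_coords_convergent_subseq[OF E(1), of "\<lambda>b n. inner b (f n)"] by blast
  then obtain c where c: "\<And>b. b \<in> E \<Longrightarrow> (\<lambda>n. inner b (f (r n))) \<longlonglongrightarrow> c b"
    by (auto simp: convergent_def o_def) metis
  have "(\<lambda>n. \<Sum>b\<in>E. (inner b (f (r n)) / inner b b) *\<^sub>R b)
      \<longlonglongrightarrow> (\<Sum>b\<in>E. (c b / inner b b) *\<^sub>R b)"
    unfolding divide_inverse by (intro tendsto_intros c)
  then have "(f \<circ> r) \<longlonglongrightarrow> (\<Sum>b\<in>E. (c b / inner b b) *\<^sub>R b)"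
    unfolding expand o_def .
  with r(1) show thesis by (rule that)
qed

text \<open>With \<open>\<epsilon> = 3 * \<delta>\<close> the descent says that \<open>W\<close>
  drops by at least \<open>2 * \<delta> * l n + \<delta> * l (Suc n)\<close>. From \<open>N\<close>
  on, the error bound converts part of this drop into a fixed fraction of \<open>D (Suc n)\<close>.
  Before \<open>N\<close> each step only needs a factor of its own below 1, and a maximum of
  finitely many such factors is still below 1.\<close>

lemma geometric_lyapunov_contraction:
  fixes D l :: "nat \<Rightarrow> real"
  assumes \<epsilon>: "0 < \<epsilon>" "\<epsilon> < 1" and D: "\<And>n. 0 \<le> D n" and l: "\<And>n. 0 \<le> l n"
    and descent: "\<And>n. D (Suc (Suc n)) + l (Suc n) \<le> D (Suc n) + (1 - \<epsilon>) * l n"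
    and K: "K > 0" and error_bound: "\<And>n. N \<le> n \<Longrightarrow> D (Suc n) \<le> K * (l (Suc n) + l n)"
    and fixed: "\<And>n. l (Suc n) = 0 \<Longrightarrow> l n = 0 \<Longrightarrow> D (Suc n) = 0"
  obtains q \<delta> where "0 < q" "q < 1" "0 < \<delta>" "\<delta> < 1"
    "\<And>n. D (Suc (Suc n)) + (1 - \<delta>) * l (Suc n) \<le> q * (D (Suc n) + (1 - \<delta>) * l n)"
proof -
  \<comment> \<open>One third of the margin goes into the weight of \<open>l\<close> in
    \<open>W\<close>, one third pays for the error bound, and one third is left to contract the
    \<open>l\<close> term.\<close>
  define \<delta> where "\<delta> = \<epsilon> / 3"
  have \<delta>: "0 < \<delta>" "\<delta> < 1" "\<epsilon> = 3 * \<delta>" using \<epsilon> by (auto simp: \<delta>_def)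
  define W where "W n = D (Suc n) + (1 - \<delta>) * l n" for n
  have W0: "0 \<le> W n" for n using D l \<delta> by (simp add: W_def)
  \<comment> \<open>The first entry contracts the \<open>l\<close> term and keeps \<open>q0\<close>
    positive; the second contracts the \<open>D\<close> term.\<close>
  define q0 where "q0 = max (1 - \<delta>) (1 - \<delta> / K)"
  have q0: "0 < q0" "q0 < 1" using \<delta> K by (auto simp: q0_def)
  have late: "W (Suc n) \<le> q0 * W n" if "N \<le> n" for n
  proof -
    have "\<delta> * (D (Suc n) / K - l n) \<le> \<delta> * l (Suc n)"
      using error_bound[OF that] K \<delta> by (intro mult_left_mono) (auto simp: field_simps)
    then have "W (Suc n) \<le> (1 - \<delta> / K) * D (Suc n) + (1 - 2 * \<delta>) * l n"
      using descent[of n] \<delta>(3) by (simp add: W_def algebra_simps)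
    also have "\<dots> \<le> q0 * D (Suc n) + (q0 * (1 - \<delta>)) * l n"
    proof (intro add_mono mult_right_mono D l)
      have "1 - 2 * \<delta> \<le> (1 - \<delta>) * (1 - \<delta>)" by (simp add: algebra_simps)
      also have "\<dots> \<le> q0 * (1 - \<delta>)" using \<delta> by (intro mult_right_mono) (auto simp: q0_def)
      finally show "1 - 2 * \<delta> \<le> q0 * (1 - \<delta>)" .
    qed (simp add: q0_def)
    finally show ?thesis by (simp add: W_def algebra_simps)
  qed
  have early: "\<exists>q<1. W (Suc n) \<le> q * W n" for n
  proof (cases "W n = 0")
    case True
    then have "D (Suc n) = 0" "l n = 0"
      using D[of "Suc n"] l[of n] \<delta> by (auto simp: W_def add_nonneg_eq_0_iff)
    then have "D (Suc (Suc n)) = 0" "l (Suc n) = 0"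
      using descent[of n] D[of "Suc (Suc n)"] l[of "Suc n"] by auto
    then show ?thesis using True by (intro exI[of _ 0]) (simp add: W_def)
  next
    case False
    then have pos: "0 < W n" using W0[of n] by simp
    have eq: "W (Suc n) \<le> W n - 2 * \<delta> * l n - \<delta> * l (Suc n)"
      using descent[of n] \<delta>(3) by (simp add: W_def algebra_simps)
    \<comment> \<open>If both values of \<open>l\<close> vanished, \<open>fixed\<close> would make
      \<open>D (Suc n)\<close>, and hence \<open>W n\<close>, zero.\<close>
    have "0 < l n \<or> 0 < l (Suc n)"
      using fixed[of n] l[of n] l[of "Suc n"] False by (force simp: W_def)
    then have "0 < 2 * \<delta> * l n + \<delta> * l (Suc n)"
      using \<delta> l by (auto intro: add_pos_nonneg add_nonneg_pos)
    then have "W (Suc n) < W n" using eq by linarith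
    then show ?thesis using pos by (intro exI[of _ "W (Suc n) / W n"]) auto
  qed
  then obtain Q where Q: "\<And>n. Q n < 1" "\<And>n. W (Suc n) \<le> Q n * W n" by metis
  define q where "q = Max (insert q0 (Q ` {..<N}))"
  have "W (Suc n) \<le> q * W n" for n
  proof (cases "N \<le> n")
    case True
    have "q0 \<le> q" by (simp add: q_def)
    then show ?thesis using late[OF True] W0[of n] mult_right_mono order_trans by blast
  next
    case False
    then have "Q n \<le> q" by (auto simp: q_def)
    then show ?thesis using Q(2)[of n] W0[of n] mult_right_mono order_trans by blast
  qed
  moreover have "q < 1" using q0 Q by (auto simp: q_def)
  moreover have "0 < q" using q0 by (auto simp: q_def less_le_trans intro: less_le_trans[OF q0(1)])
  ultimately show thesis using that[of q \<delta>] \<delta> by (simp add: W_def)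
qed

text \<open>A geometric sum bounds the displacement from \<open>a n\<close> to every later term.
  This yields the Cauchy property, and letting the later index tend to infinity yields the
  rate.\<close>

lemma geometric_increments_converge:
  fixes a :: "nat \<Rightarrow> 'a::{real_normed_vector, complete_space}"
  assumes \<rho>: "0 \<le> \<rho>" "\<rho> < 1" and step: "\<And>n. norm (a (Suc n) - a n) \<le> b * \<rho> ^ n"
  obtains l where "a \<longlonglongrightarrow> l" "\<And>n. norm (a n - l) \<le> b / (1 - \<rho>) * \<rho> ^ n"
proof -
  have b: "0 \<le> b" using order_trans[OF norm_ge_zero step[of 0]] by simp
  \<comment> \<open>The bound is the exact partial geometric sum, which lets the induction close;
    the subtracted power is dropped afterwards.\<close>
  have "norm (a (n + k) - a n) \<le> b / (1 - \<rho>) * (\<rho> ^ n - \<rho> ^ (n + k))" for n k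
  proof (induction k)
    case (Suc k)
    have "norm (a (n + Suc k) - a n) \<le> norm (a (Suc (n + k)) - a (n + k)) + norm (a (n + k) - a n)"
      using norm_triangle_ineq[of "a (Suc (n + k)) - a (n + k)" "a (n + k) - a n"] by simp
    also have "\<dots> \<le> b * \<rho> ^ (n + k) + b / (1 - \<rho>) * (\<rho> ^ n - \<rho> ^ (n + k))"
      by (intro add_mono step Suc)
    also have "\<dots> = b / (1 - \<rho>) * (\<rho> ^ n - \<rho> ^ (n + Suc k))"
      using \<rho> by (simp add: field_simps)
    finally show ?case .
  qed simp
  moreover have "b / (1 - \<rho>) * (\<rho> ^ n - \<rho> ^ (n + k)) \<le> b / (1 - \<rho>) * \<rho> ^ n" for n k
    using \<rho> b by (intro mult_left_mono) auto
  ultimately have far: "norm (a (n + k) - a n) \<le> b / (1 - \<rho>) * \<rho> ^ n" for n k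
    using order_trans by blast
  have lim0: "(\<lambda>n. b / (1 - \<rho>) * \<rho> ^ n) \<longlonglongrightarrow> 0"
    using tendsto_mult_right_zero[OF LIMSEQ_realpow_zero[OF \<rho>]] .
  have "Cauchy a"
  proof (rule CauchyI)
    fix e :: real assume "0 < e"
    then obtain N where N: "b / (1 - \<rho>) * \<rho> ^ N < e / 2"
      using order_tendstoD(2)[OF lim0, of "e / 2"] by (auto simp: eventually_sequentially)
    have "norm (a n - a N) < e / 2" if "N \<le> n" for n
      using le_less_trans[OF far[of N "n - N"] N] that by simp
    then show "\<exists>N. \<forall>m\<ge>N. \<forall>n\<ge>N. norm (a m - a n) < e"
      by (intro exI[of _ N] allI impI) (metis norm_diff_triangle_less norm_minus_commute field_sum_of_halves)
  qed
  then obtain l where l: "a \<longlonglongrightarrow> l" using Cauchy_convergent convergent_def by blast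
  have "norm (a n - l) \<le> b / (1 - \<rho>) * \<rho> ^ n" for n
  proof (rule LIMSEQ_le_const2)
    have "(\<lambda>k. norm (a n - a (k + n))) \<longlonglongrightarrow> norm (a n - l)"
      by (intro tendsto_intros LIMSEQ_ignore_initial_segment l)
    then show "(\<lambda>k. norm (a n - a (k + n))) \<longlonglongrightarrow> norm (a n - l)" .
  qed (use far[of n] in \<open>simp add: norm_minus_commute[of "a n"] add.commute[of _ n]\<close>)
  with l show thesis by (rule that)
qed

section \<open>The algebraic identity behind the deviations, and comparison with the ambient
  norm\<close>

context strongly_positive_operator
begin

text \<open>Here \<open>g\<close> stands for \<open>\<gamma> n * \<beta>\<close>. The left side
  gathers what remains after expanding the new squared distance and using monotonicity; the right
  side is the expression capped by the deviation condition. The weights \<theta>, \<alpha>, \<eta>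
  are such that the coefficients of \<open>ip d d\<close>, \<open>ip d u\<close>,
  \<open>ip d v\<close> and \<open>ip u v\<close> all cancel; the facts \<open>dd\<close> to
  \<open>vv\<close> evaluate the six coefficients.\<close>

lemma deviation_identity:
  fixes d u v :: 'a and lam g E D :: real
  assumes E: "E = 2 - lam * g" "E \<noteq> 0" and D: "D = 4 - 2 * lam - g" "D \<noteq> 0"
  defines "\<theta> \<equiv> (1 - lam) * g / E" and "\<alpha> \<equiv> lam * g / E" and "\<eta> \<equiv> 2 * (1 - lam) / D"
  defines "s \<equiv> d - \<theta> *\<^sub>R u - v" and "r \<equiv> d + \<alpha> *\<^sub>R u - \<eta> *\<^sub>R v"
  shows "lam\<^sup>2 * (nm s)\<^sup>2 + lam * g / 2 * (nm (d - u))\<^sup>2 - 2 * lam * ip s d + lam * D / 2 * (nm r)\<^sup>2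
    = lam * g / E * (nm u)\<^sup>2 + lam * E / D * (nm v)\<^sup>2"
proof -
  have dd: "lam\<^sup>2 + lam * g / 2 - 2 * lam + lam * D / 2 = 0"
    by (simp add: D(1) field_simps power2_eq_square)
  have "\<alpha> * D * lam + 2 * lam * \<theta> - lam * g - 2 * lam\<^sup>2 * \<theta>
      = lam * g / E * (lam * D + 2 * (1 - lam)\<^sup>2 - E)"
    using E(2) by (simp add: \<alpha>_def \<theta>_def field_simps power2_eq_square)
  also have "lam * D + 2 * (1 - lam)\<^sup>2 - E = 0"
    by (simp add: D(1) E(1) power2_eq_square algebra_simps)
  finally have du: "\<alpha> * D * lam + 2 * lam * \<theta> - lam * g - 2 * lam\<^sup>2 * \<theta> = 0" by simp
  have dv: "2 * lam - 2 * lam\<^sup>2 - lam * D * \<eta> = 0"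
    using D(2) by (simp add: \<eta>_def field_simps power2_eq_square)
  have uv: "2 * lam\<^sup>2 * \<theta> - lam * D * \<alpha> * \<eta> = 0"
    using D(2) E(2) by (simp add: \<eta>_def \<alpha>_def \<theta>_def field_simps power2_eq_square)
  have "lam * g / 2 + lam\<^sup>2 * \<theta>\<^sup>2 + lam * D / 2 * \<alpha>\<^sup>2
      = lam * g / (2 * E\<^sup>2) * (E\<^sup>2 + 2 * lam * (1 - lam)\<^sup>2 * g + D * lam\<^sup>2 * g)"
    using E(2) by (simp add: \<alpha>_def \<theta>_def field_simps power2_eq_square)
  also have "E\<^sup>2 + 2 * lam * (1 - lam)\<^sup>2 * g + D * lam\<^sup>2 * g = 2 * E"
    by (simp add: D(1) E(1) power2_eq_square algebra_simps)
  finally have uu: "lam * g / 2 + lam\<^sup>2 * \<theta>\<^sup>2 + lam * D / 2 * \<alpha>\<^sup>2 = lam * g / E"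
    using E(2) by (simp add: power2_eq_square)
  have "lam\<^sup>2 + lam * D / 2 * \<eta>\<^sup>2 = lam / D * (lam * D + 2 * (1 - lam)\<^sup>2)"
    using D(2) by (simp add: \<eta>_def field_simps power2_eq_square)
  also have "lam * D + 2 * (1 - lam)\<^sup>2 = E"
    by (simp add: D(1) E(1) power2_eq_square algebra_simps)
  finally have vv: "lam\<^sup>2 + lam * D / 2 * \<eta>\<^sup>2 = lam * E / D" by simp
  have "lam\<^sup>2 * (nm s)\<^sup>2 + lam * g / 2 * (nm (d - u))\<^sup>2 - 2 * lam * ip s d + lam * D / 2 * (nm r)\<^sup>2
    = (lam\<^sup>2 + lam * g / 2 - 2 * lam + lam * D / 2) * ip d d
    + (\<alpha> * D * lam + 2 * lam * \<theta> - lam * g - 2 * lam\<^sup>2 * \<theta>) * ip d u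
    + (2 * lam - 2 * lam\<^sup>2 - lam * D * \<eta>) * ip d v
    + (2 * lam\<^sup>2 * \<theta> - lam * D * \<alpha> * \<eta>) * ip u v
    + (lam * g / 2 + lam\<^sup>2 * \<theta>\<^sup>2 + lam * D / 2 * \<alpha>\<^sup>2) * ip u u
    + (lam\<^sup>2 + lam * D / 2 * \<eta>\<^sup>2) * ip v v"
    unfolding nm_sq s_def r_def ip.diff_left ip.diff_right ip.add_left ip.add_right
      ip.scaleR_left ip.scaleR_right ip_commute[of u d] ip_commute[of v d] ip_commute[of v u]
      real_scaleR_def
    by (simp add: field_simps power2_eq_square)
  then show ?thesis unfolding dd du dv uv uu vv nm_sq by simp
qed

lemma nm_le_norm: obtains c where "c > 0" "\<And>x. nm x \<le> c * norm x"
proof -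
  obtain K where K: "K > 0" "\<And>x. norm (M x) \<le> norm x * K" using M.pos_bounded by blast
  have "nm x \<le> sqrt K * norm x" for x
  proof (rule power2_le_imp_le)
    have "ip x x \<le> norm x * (norm x * K)"
      using norm_cauchy_schwarz[of x "M x"] mult_left_mono[OF K(2)[of x], of "norm x"]
      by (simp add: ip_def)
    then show "(nm x)\<^sup>2 \<le> (sqrt K * norm x)\<^sup>2"
      using K(1) by (simp add: nm_sq power_mult_distrib) (simp add: power2_eq_square algebra_simps)
  qed (use K in simp)
  then show thesis using K(1) by (intro that[of "sqrt K"]) auto
qed

lemma tendsto_zero_nm:
  assumes "(\<lambda>n. nm (f n)) \<longlonglongrightarrow> 0"
  shows "f \<longlonglongrightarrow> 0"
proof -
  obtain c where c: "c > 0" "\<And>x. norm x \<le> c * nm x" by (rule norm_le_nm) blast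
  have "(\<lambda>n. c * nm (f n)) \<longlonglongrightarrow> 0" using tendsto_mult_right_zero[OF assms] .
  then show ?thesis by (rule Lim_null_comparison[rotated]) (simp add: c(2))
qed

lemma dist_wrt_nonempty:
  assumes "S \<noteq> {}"
  shows "dist_wrt M x S = ereal (INF y\<in>S. nm (x - y))"
proof -
  have "bdd_below ((\<lambda>y. nm (x - y)) ` S)" by (rule bdd_belowI2[of _ 0]) simp
  then show ?thesis using assms by (simp add: dist_wrt_def ereal_Inf' image_image)
qed

end

section \<open>The inclusion \<open>0 \<in> A x + C x\<close>: closedness and the basic
  inequality\<close>

locale cocoercive_inclusion = strongly_positive_operator M
  for M :: "'a::{real_inner, complete_space} \<Rightarrow> 'a" +
  fixes A :: "'a \<Rightarrow> 'a set" and C :: "'a \<Rightarrow> 'a" and \<beta> :: real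
  assumes beta: "\<beta> > 0"
    and maximal: "maximally_monotone A"
    and cocoercive: "cocoercive_wrt M (1 / \<beta>) C"
begin

abbreviation T :: "'a \<Rightarrow> 'a set" where
  "T \<equiv> sum_mapping A C"

abbreviation Z :: "'a set" where
  "Z \<equiv> zer T"

text \<open>This represents \<open>C\<close> in the inner product \<open>ip\<close>, so that
  cocoercivity involves the single norm \<open>nm\<close> instead of \<open>nm\<close> and its
  dual.\<close>

definition G :: "'a \<Rightarrow> 'a" where
  "G x = inv M (C x)"

lemma M_G [simp]: "M (G x) = C x"
  by (simp add: G_def)

lemma monotone: "a \<in> A x \<Longrightarrow> b \<in> A y \<Longrightarrow> 0 \<le> inner (a - b) (x - y)"
  using maximal by (auto simp: maximally_monotone_def monotone_mapping_def)

lemma G_cocoercive: "(nm (G x - G y))\<^sup>2 \<le> \<beta> * ip (G x - G y) (x - y)"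
proof -
  have "(1 / \<beta>) * (nm (G x - G y))\<^sup>2 \<le> ip (G x - G y) (x - y)"
    using cocoercive
    by (simp add: cocoercive_wrt_def norm_wrt_inv inner_eq_ip inv_M_diff G_def)
  then show ?thesis using beta by (simp add: field_simps)
qed

lemma G_lipschitz: "nm (G x - G y) \<le> \<beta> * nm (x - y)"
proof (cases "nm (G x - G y) = 0")
  case False
  have "nm (G x - G y) * nm (G x - G y) \<le> nm (G x - G y) * (\<beta> * nm (x - y))"
    using order_trans[OF G_cocoercive mult_left_mono[OF ip_le_nm less_imp_le[OF beta]]]
    by (simp add: power2_eq_square mult.left_commute)
  then show ?thesis using False nm_nonneg[of "G x - G y"] by (simp add: mult_le_cancel_left order.strict_iff_order)
qed (use beta in simp)

lemma C_tendsto: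
  assumes "f \<longlonglongrightarrow> a"
  shows "(\<lambda>n. C (f n)) \<longlonglongrightarrow> C a"
proof -
  obtain c where c: "c > 0" "\<And>x. nm x \<le> c * norm x" by (rule nm_le_norm) blast
  have "(\<lambda>n. \<beta> * (c * norm (f n - a))) \<longlonglongrightarrow> \<beta> * (c * 0)"
    by (intro tendsto_mult tendsto_const) (use assms in \<open>simp add: LIM_zero tendsto_norm_zero\<close>)
  then have "(\<lambda>n. \<beta> * (c * norm (f n - a))) \<longlonglongrightarrow> 0" by simp
  then have "(\<lambda>n. nm (G (f n) - G a)) \<longlonglongrightarrow> 0"
  proof (rule Lim_null_comparison[rotated])
    show "\<forall>\<^sub>F n in sequentially. norm (nm (G (f n) - G a)) \<le> \<beta> * (c * norm (f n - a))"
      using order_trans[OF G_lipschitz mult_left_mono[OF c(2)]] beta by simp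
  qed
  then have "(\<lambda>n. M (G (f n) - G a)) \<longlonglongrightarrow> 0"
    by (intro M.tendsto_zero tendsto_zero_nm)
  then show ?thesis by (simp add: M.diff LIM_zero_iff)
qed

text \<open>Closedness of the graph of a maximally monotone operator: passing to the limit in the
  monotonicity inequalities shows that adjoining \<open>- C a\<close> to \<open>A a\<close> keeps
  \<open>A\<close> monotone, so maximality means that it was there already.\<close>

lemma zero_if_approximate_zeros:
  assumes f: "f \<longlonglongrightarrow> a" and w: "w \<longlonglongrightarrow> 0" and T: "\<And>n. w n \<in> T (f n)"
  shows "a \<in> Z"
proof -
  define B where "B = A(a := insert (- C a) (A a))"
  have pos: "0 \<le> inner (- C a - b) (a - y)" if b: "b \<in> A y" for y b
  proof (rule tendsto_lowerbound)
    have "(\<lambda>n. inner (w n - C (f n) - b) (f n - y)) \<longlonglongrightarrow> inner (0 - C a - b) (a - y)"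
      by (intro tendsto_intros C_tendsto f w)
    then show "(\<lambda>n. inner (w n - C (f n) - b) (f n - y)) \<longlonglongrightarrow> inner (- C a - b) (a - y)"
      by simp
    have "0 \<le> inner (w n - C (f n) - b) (f n - y)" for n
    proof -
      obtain c where "c \<in> A (f n)" "w n = c + C (f n)"
        using T[of n] by (auto simp: sum_mapping_def)
      then show ?thesis using monotone[OF _ b] by simp
    qed
    then show "\<forall>\<^sub>F n in sequentially. 0 \<le> inner (w n - C (f n) - b) (f n - y)" by simp
  qed simp
  have pos': "0 \<le> inner (b + C a) (y - a)" if b: "b \<in> A y" for y b
    using pos[OF b] by (simp add: inner_diff_left inner_diff_right inner_add_left algebra_simps)
  have "monotone_mapping B"
    unfolding monotone_mapping_def B_def using monotone pos pos'
    by (auto simp: split: if_splits)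
  then have "B = A"
    using maximal by (auto simp: maximally_monotone_def B_def)
  then have "- C a \<in> A a" by (metis B_def fun_upd_same insertI1)
  then show ?thesis by (force simp: zer_def sum_mapping_def)
qed

text \<open>Monotonicity of \<open>A\<close> is used between \<open>p\<close> and \<open>xs\<close>.
  Since \<open>C\<close> is evaluated at \<open>y\<close> and not at \<open>p\<close>, an error term
  \<open>ip e (p - y)\<close> appears; cocoercivity supplies the square of \<open>e\<close> needed
  to absorb it.\<close>

lemma forward_backward_monotonicity:
  assumes "xs \<in> Z" and "\<gamma> > 0" and "M z - \<gamma> *\<^sub>R C y \<in> sum_mapping (scale_mapping \<gamma> A) M p"
  shows "2 * ip (p - z) (p - xs) \<le> \<gamma> * \<beta> / 2 * (nm (p - y))\<^sup>2"
proof -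
  obtain a where a: "a \<in> A p" "M z - \<gamma> *\<^sub>R C y = \<gamma> *\<^sub>R a + M p"
    using assms(3) by (auto simp: sum_mapping_def scale_mapping_def)
  obtain b where b: "b \<in> A xs" "b = - C xs"
    using assms(1) by (auto simp: zer_def sum_mapping_def) (metis eq_neg_iff_add_eq_0)
  define e where "e = G y - G xs"
  have "\<gamma> *\<^sub>R (a - b) = M (z - p - \<gamma> *\<^sub>R e)"
    using a(2) b(2) by (simp add: e_def M.diff M.scaleR scaleR_diff_right) (simp add: algebra_simps)
  then have "0 \<le> ip (z - p - \<gamma> *\<^sub>R e) (p - xs)"
    using monotone[OF a(1) b(1)] assms(2) ip_commute[of "z - p - \<gamma> *\<^sub>R e" "p - xs"]
    by (simp add: ip_def inner_commute[of "p - xs"] flip: \<open>\<gamma> *\<^sub>R (a - b) = _\<close>)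
  then have 1: "\<gamma> * ip e (p - xs) \<le> - ip (p - z) (p - xs)"
    by (simp add: ip.diff_left ip.scaleR_left)
  have 2: "ip e (p - xs) = ip e (y - xs) + ip e (p - y)"
    by (simp add: ip.diff_right)
  \<comment> \<open>Completing the square: with weight \<open>\<beta> / 2\<close> the cross term
    gets the factor \<beta> that cocoercivity also carries, so the two inner products merge into
    \<open>ip e (p - xs)\<close>.\<close>
  have "0 \<le> (nm (e + (\<beta> / 2) *\<^sub>R (p - y)))\<^sup>2" by simp
  also have "\<dots> = (nm e)\<^sup>2 + \<beta> * ip e (p - y) + \<beta>\<^sup>2 / 4 * (nm (p - y))\<^sup>2"
    unfolding nm_sq ip.add_left ip.add_right ip.scaleR_left ip.scaleR_right
    by (simp add: ip_commute[of "p - y" e] power2_eq_square field_simps)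
  also have "\<dots> \<le> \<beta> * ip e (y - xs) + \<beta> * ip e (p - y) + \<beta>\<^sup>2 / 4 * (nm (p - y))\<^sup>2"
    using G_cocoercive[of y xs] by (simp add: e_def)
  also have "\<dots> = \<beta> * (ip e (p - xs) + \<beta> / 4 * (nm (p - y))\<^sup>2)"
    by (simp add: 2 power2_eq_square algebra_simps)
  finally have "0 \<le> ip e (p - xs) + \<beta> / 4 * (nm (p - y))\<^sup>2"
    using beta by (simp add: zero_le_mult_iff)
  then have "0 \<le> \<gamma> * (ip e (p - xs) + \<beta> / 4 * (nm (p - y))\<^sup>2)"
    using assms(2) by simp
  with 1 show ?thesis by (simp add: algebra_simps)
qed

end

section \<open>Runs of the algorithm: parameter bounds and descent\<close>

locale deviated_forward_backward = cocoercive_inclusion M A C \<beta>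
  for M :: "'a::{real_inner, complete_space} \<Rightarrow> 'a" and A C \<beta> +
  fixes \<epsilon> :: real and \<zeta> \<gamma> lam L :: "nat \<Rightarrow> real"
    and x u v y z p :: "nat \<Rightarrow> 'a"
  assumes eps: "0 < \<epsilon>" "\<epsilon> < 1"
    and zeta: "\<And>n. 0 \<le> \<zeta> n \<and> \<zeta> n \<le> 1 - \<epsilon>"
    and gamma: "\<And>n. \<epsilon> \<le> \<gamma> n \<and> \<gamma> n \<le> (4 - 3 * \<epsilon>) / \<beta>"
    and lam: "\<And>n. \<epsilon> \<le> lam n \<and> lam n \<le> 2 - \<gamma> n * \<beta> / 2 - \<epsilon> / 2"
    and run: "fb_deviations M A C \<beta> \<zeta> \<gamma> lam x u v y z p L"
begin

abbreviation (input) E :: "nat \<Rightarrow> real" where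
  "E n \<equiv> 2 - lam n * \<gamma> n * \<beta>"

abbreviation (input) D :: "nat \<Rightarrow> real" where
  "D n \<equiv> 4 - 2 * lam n - \<gamma> n * \<beta>"

definition r :: "nat \<Rightarrow> 'a" where
  "r n = p n - x n + (lam n * \<gamma> n * \<beta> / E n) *\<^sub>R u n - (2 * (1 - lam n) / D n) *\<^sub>R v n"

lemma y_eq: "y n = x n + u n"
  and z_eq: "z n = x n + ((1 - lam n) * \<gamma> n * \<beta> / E n) *\<^sub>R u n + v n"
  and p_mem: "M (z n) - \<gamma> n *\<^sub>R C (y n) \<in> sum_mapping (scale_mapping (\<gamma> n) A) M (p n)"
  and x_Suc: "x (Suc n) = x n + lam n *\<^sub>R (p n - z n)"
  and L_eq: "L n = lam n * D n / 2 * (nm (r n))\<^sup>2"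
  and deviation_bound:
    "lam (Suc n) * \<gamma> (Suc n) * \<beta> / E (Suc n) * (nm (u (Suc n)))\<^sup>2
      + lam (Suc n) * E (Suc n) / D (Suc n) * (nm (v (Suc n)))\<^sup>2 \<le> \<zeta> n * L n"
  using run unfolding fb_deviations_def r_def inverse_mapping_def mem_Collect_eq by blast+

lemma gamma_beta: "\<epsilon> * \<beta> \<le> \<gamma> n * \<beta>" "\<gamma> n * \<beta> \<le> 4"
  using gamma[of n] beta eps by (auto simp: field_simps)

lemma lam_le: "lam n \<le> 2" and lam_pos: "0 < lam n" and gamma_pos: "0 < \<gamma> n"
  using lam[of n] gamma[of n] gamma_beta(1)[of n] mult_pos_pos[OF eps(1) beta] eps by auto

lemma D_bounds: "\<epsilon> \<le> D n" "D n \<le> 4"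
  using lam[of n] lam_pos[of n] mult_pos_pos[OF gamma_pos[of n] beta] by auto

text \<open>The product \<open>lam n * (\<gamma> n * \<beta>)\<close> is at most \<open>g (4 - \<epsilon> - g) / 2\<close> with \<open>g = \<gamma> n * \<beta>\<close>, hence at
  most \<open>(4 - \<epsilon>)\<^sup>2 / 8\<close>.\<close>

lemma E_bounds: "\<epsilon> / 2 \<le> E n" "E n \<le> 2"
proof -
  define g where "g = \<gamma> n * \<beta>"
  have g: "0 < g" using gamma_pos beta by (simp add: g_def)
  have "lam n * g \<le> (2 - g / 2 - \<epsilon> / 2) * g"
    using lam[of n] g by (intro mult_right_mono) (auto simp: g_def)
  also have "\<dots> \<le> (4 - \<epsilon>)\<^sup>2 / 8"
    using zero_le_power2[of "(4 - \<epsilon>) - 2 * g"] by (simp add: power2_eq_square algebra_simps)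
  also have "\<dots> \<le> 2 - \<epsilon> / 2"
  proof -
    have "\<epsilon> * \<epsilon> \<le> 1 * \<epsilon>" using eps by (intro mult_right_mono) auto
    moreover have "(4 - \<epsilon>)\<^sup>2 / 8 = 2 - \<epsilon> + \<epsilon> * \<epsilon> / 8"
      by (simp add: power2_eq_square field_simps)
    ultimately show ?thesis using eps by linarith
  qed
  finally show "\<epsilon> / 2 \<le> E n" by (simp add: g_def mult.assoc)
  show "E n \<le> 2" using lam_pos[of n] gamma_pos[of n] beta by simp
qed

lemma E_pos: "0 < E n" and D_pos: "0 < D n"
  using E_bounds(1)[of n] D_bounds(1)[of n] eps by linarith+

lemma L_nonneg: "0 \<le> L n"
  unfolding L_eq using lam_pos[of n] D_pos[of n] by simp

text \<open>Expand the squared distance of \<open>x (Suc m)\<close> to \<open>xs\<close> around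
  \<open>x m\<close>, bound the cross term by \<open>forward_backward_monotonicity\<close>, and use
  \<open>deviation_identity\<close> to trade the remainder for \<open>- L m\<close> plus the
  deviation terms, which the choice of \<open>u\<close> and \<open>v\<close> caps by
  \<open>\<zeta> n * L n\<close>.\<close>

lemma descent:
  assumes "xs \<in> Z"
  shows "(nm (x (Suc (Suc n)) - xs))\<^sup>2 + L (Suc n) \<le> (nm (x (Suc n) - xs))\<^sup>2 + (1 - \<epsilon>) * L n"
proof -
  \<comment> \<open>The deviations of step \<open>Suc n\<close> are controlled by
    \<open>L n\<close>, so the estimate concerns indices from 1 on.\<close>
  define m where "m = Suc n"
  define s where "s = p m - z m"
  define d where "d = p m - x m"
  have s: "s = d - ((1 - lam m) * (\<gamma> m * \<beta>) / E m) *\<^sub>R u m - v m"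
    by (simp add: s_def d_def z_eq algebra_simps)
  have r: "r m = d + (lam m * (\<gamma> m * \<beta>) / E m) *\<^sub>R u m - (2 * (1 - lam m) / D m) *\<^sub>R v m"
    by (simp add: r_def d_def mult.assoc)
  have identity: "(lam m)\<^sup>2 * (nm s)\<^sup>2 + lam m * (\<gamma> m * \<beta>) / 2 * (nm (d - u m))\<^sup>2
      - 2 * lam m * ip s d + L m
    = lam m * (\<gamma> m * \<beta>) / E m * (nm (u m))\<^sup>2 + lam m * E m / D m * (nm (v m))\<^sup>2"
    unfolding L_eq r s
    using E_pos[of m] D_pos[of m] by (intro deviation_identity) (simp_all add: mult.assoc)
  have "2 * ip s (p m - xs) \<le> \<gamma> m * \<beta> / 2 * (nm (p m - y m))\<^sup>2"
    unfolding s_def by (rule forward_backward_monotonicity[OF assms gamma_pos p_mem])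
  also have "p m - y m = d - u m" by (simp add: d_def y_eq)
  finally have "lam m * (2 * ip s (p m - xs)) \<le> lam m * (\<gamma> m * \<beta> / 2 * (nm (d - u m))\<^sup>2)"
    using lam_pos[of m] by (intro mult_left_mono) auto
  \<comment> \<open>Monotonicity speaks of \<open>p m\<close>, the expansion of \<open>x m\<close>;
    the difference \<open>ip s d\<close> is the one appearing in the identity.\<close>
  moreover have "lam m * ip s (x m - xs) = lam m * ip s (p m - xs) - lam m * ip s d"
    by (simp add: d_def ip.diff_right algebra_simps)
  moreover have "(nm (x (Suc m) - xs))\<^sup>2
      = (nm (x m - xs))\<^sup>2 + 2 * lam m * ip s (x m - xs) + (lam m)\<^sup>2 * (nm s)\<^sup>2"
  proof -
    have "x (Suc m) - xs = (x m - xs) + lam m *\<^sub>R s"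
      by (simp add: x_Suc s_def)
    then show ?thesis
      unfolding nm_sq by (simp only: ip.add_left ip.add_right ip.scaleR_left ip.scaleR_right
          ip_commute[of "x m - xs" s]) (simp add: power2_eq_square algebra_simps)
  qed
  ultimately have "(nm (x (Suc m) - xs))\<^sup>2 + L m \<le> (nm (x m - xs))\<^sup>2
      + (lam m * (\<gamma> m * \<beta>) / E m * (nm (u m))\<^sup>2 + lam m * E m / D m * (nm (v m))\<^sup>2)"
    unfolding identity[symmetric] by (simp add: algebra_simps)
  also have "\<dots> \<le> (nm (x m - xs))\<^sup>2 + \<zeta> n * L n"
    using deviation_bound[of n] by (simp add: m_def mult.assoc)
  also have "\<dots> \<le> (nm (x m - xs))\<^sup>2 + (1 - \<epsilon>) * L n"
    using zeta[of n] L_nonneg[of n] by (simp add: mult_right_mono)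
  finally show ?thesis by (simp add: m_def)
qed

section \<open>Bounds on residuals and increments\<close>

definition S :: "nat \<Rightarrow> real" where
  "S n = sqrt (L (Suc n)) + sqrt (L n)"

text \<open>The resolvent equation gives an element of \<open>A (p n)\<close>. Replacing
  \<open>C (y n)\<close> by \<open>C (p n)\<close> in it and applying the inverse of
  \<open>M\<close> gives this vector.\<close>

definition \<omega> :: "nat \<Rightarrow> 'a" where
  "\<omega> n = (1 / \<gamma> n) *\<^sub>R (z n - p n) - (G (y n) - G (p n))"

lemma M_omega_mem: "M (\<omega> n) \<in> T (p n)"
proof -
  obtain a where a: "a \<in> A (p n)" "M (z n) - \<gamma> n *\<^sub>R C (y n) = \<gamma> n *\<^sub>R a + M (p n)"
    using p_mem[of n] by (auto simp: sum_mapping_def scale_mapping_def)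
  have "M (z n) - M (p n) = \<gamma> n *\<^sub>R (a + C (y n))"
    using a(2) by (simp add: algebra_simps)
  then have "M (\<omega> n) = a + C (p n)"
    using gamma_pos[of n] by (simp add: \<omega>_def M.diff M.scaleR)
  then show ?thesis using a(1) by (auto simp: sum_mapping_def)
qed

lemma S_nonneg: "0 \<le> S n"
  using L_nonneg by (simp add: S_def)

lemma S_power2_le: "(S n)\<^sup>2 \<le> 2 * (L (Suc n) + L n)"
  unfolding S_def using L_nonneg[of n] L_nonneg[of "Suc n"]
    sum_squares_bound[of "sqrt (L (Suc n))" "sqrt (L n)"] by (simp add: power2_sum)

text \<open>The parameter bounds keep every coefficient of a squared norm in \<open>L\<close> and in
  the deviation condition above a common positive constant. The residual at \<open>Suc n\<close> is
  then governed by \<open>L (Suc n)\<close> and the deviations by \<open>L n\<close>, hence the two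
  roots in \<open>S n\<close>.\<close>

lemma deviations_le_S: obtains k where "0 \<le> k"
  "\<And>n. nm (r (Suc n)) \<le> k * S n" "\<And>n. nm (u (Suc n)) \<le> k * S n" "\<And>n. nm (v (Suc n)) \<le> k * S n"
proof -
  \<comment> \<open>The first entry is below both \<open>lam n * D n / 2\<close> and
    \<open>lam n * E n / D n\<close>, using \<open>E n \<ge> \<epsilon> / 2\<close> and
    \<open>D n \<le> 4\<close> for the latter; the second is below
    \<open>lam n * \<gamma> n * \<beta> / E n\<close>, using \<open>E n \<le> 2\<close>.\<close>
  define k where "k = min (\<epsilon>\<^sup>2 / 8) (\<epsilon>\<^sup>2 * \<beta> / 2)"
  have k: "0 < k" "k \<le> \<epsilon>\<^sup>2 / 8" "k \<le> \<epsilon>\<^sup>2 * \<beta> / 2" using eps beta by (auto simp: k_def)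
  have le: "nm w \<le> sqrt (1 / k) * sqrt l" if "c * (nm w)\<^sup>2 \<le> l" "k \<le> c" for w c l
  proof -
    have "k * (nm w)\<^sup>2 \<le> l" using mult_right_mono[OF that(2), of "(nm w)\<^sup>2"] that(1) by simp
    then have "(nm w)\<^sup>2 \<le> 1 / k * l" using k(1) by (simp add: field_simps)
    then have "nm w \<le> sqrt (1 / k * l)" by (rule real_le_rsqrt)
    then show ?thesis unfolding real_sqrt_mult .
  qed
  have r: "nm (r n) \<le> sqrt (1 / k) * sqrt (L n)" for n
  proof (rule le)
    have "k \<le> \<epsilon> * \<epsilon> / 2" using k(1,2) by (simp add: power2_eq_square)
    also have "\<dots> \<le> lam n * D n / 2"
      using lam[of n] D_bounds[of n] eps lam_pos[of n]
      by (intro divide_right_mono mult_mono) auto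
    finally show "k \<le> lam n * D n / 2" .
  qed (simp add: L_eq)
  let ?a = "\<lambda>n. lam n * \<gamma> n * \<beta> / E n" and ?b = "\<lambda>n. lam n * E n / D n"
  have a: "k \<le> ?a n" for n
  proof -
    have "k \<le> \<epsilon> * (\<epsilon> * \<beta>) / 2" using k(3) by (simp add: power2_eq_square mult.assoc)
    also have "\<dots> \<le> lam n * (\<gamma> n * \<beta>) / E n"
      using E_bounds[of n] gamma_beta[of n] lam[of n] beta eps lam_pos[of n] E_pos[of n]
      by (intro frac_le mult_mono) auto
    finally show ?thesis by (simp add: mult.assoc)
  qed
  have b: "k \<le> ?b n" for n
  proof -
    have "k \<le> \<epsilon> * (\<epsilon> / 2) / 4" using k(2) by (simp add: power2_eq_square)
    also have "\<dots> \<le> lam n * E n / D n"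
      using E_bounds[of n] D_bounds[of n] lam[of n] eps lam_pos[of n] D_pos[of n]
      by (intro frac_le mult_mono) auto
    finally show ?thesis .
  qed
  have bound: "?a (Suc n) * (nm (u (Suc n)))\<^sup>2 + ?b (Suc n) * (nm (v (Suc n)))\<^sup>2 \<le> L n" for n
  proof -
    have "\<zeta> n * L n \<le> 1 * L n" using zeta[of n] eps L_nonneg[of n] by (intro mult_right_mono) auto
    then show ?thesis using deviation_bound[of n] by simp
  qed
  have ab: "0 \<le> ?a n" "0 \<le> ?b n" for n using a[of n] b[of n] k(1) by linarith+
  have u: "nm (u (Suc n)) \<le> sqrt (1 / k) * sqrt (L n)"
    and v: "nm (v (Suc n)) \<le> sqrt (1 / k) * sqrt (L n)" for n
  proof -
    have "0 \<le> ?b (Suc n) * (nm (v (Suc n)))\<^sup>2" "0 \<le> ?a (Suc n) * (nm (u (Suc n)))\<^sup>2"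
      by (intro mult_nonneg_nonneg ab zero_le_power2)+
    then have "?a (Suc n) * (nm (u (Suc n)))\<^sup>2 \<le> L n" "?b (Suc n) * (nm (v (Suc n)))\<^sup>2 \<le> L n"
      using bound[of n] by linarith+
    then show "nm (u (Suc n)) \<le> sqrt (1 / k) * sqrt (L n)"
      "nm (v (Suc n)) \<le> sqrt (1 / k) * sqrt (L n)" using le a b by blast+
  qed
  have "sqrt (1 / k) * sqrt (L n) \<le> sqrt (1 / k) * S n"
    "sqrt (1 / k) * sqrt (L (Suc n)) \<le> sqrt (1 / k) * S n" for n
    using L_nonneg k(1) by (auto simp: S_def intro!: mult_left_mono)
  then show thesis
    using k(1) order_trans[OF r] order_trans[OF u] order_trans[OF v]
    by (intro that[of "sqrt (1 / k)"]) (auto simp del: real_sqrt_divide)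
qed

text \<open>Triangle inequalities in sequence: \<open>r\<close>, \<open>u\<close>, \<open>v\<close>
  control \<open>p - x\<close>, then \<open>z - p\<close> and \<open>y - p\<close>. The step is a
  multiple of \<open>z - p\<close>, and \<omega> combines \<open>z - p\<close>, with \<gamma>
  bounded below, and a Lipschitz estimate of \<open>G\<close> on \<open>y - p\<close>.\<close>

lemma increments_le_S: obtains K where "0 \<le> K"
  "\<And>n. nm (p (Suc n) - x (Suc n)) \<le> K * S n"
  "\<And>n. nm (x (Suc (Suc n)) - x (Suc n)) \<le> K * S n"
  "\<And>n. nm (\<omega> (Suc n)) \<le> K * S n"
proof -
  obtain k where k: "0 \<le> k" "\<And>n. nm (r (Suc n)) \<le> k * S n"
      "\<And>n. nm (u (Suc n)) \<le> k * S n" "\<And>n. nm (v (Suc n)) \<le> k * S n"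
    by (rule deviations_le_S) blast
  \<comment> \<open>The largest of the three coefficient bounds: \<open>lam n \<le> 2\<close>,
    \<open>\<gamma> n * \<beta> \<le> 4\<close> and \<open>E n \<ge> \<epsilon> / 2\<close> give
    \<open>16 / \<epsilon>\<close>.\<close>
  define B where "B = 16 / \<epsilon>"
  have B: "0 < B" using eps by (simp add: B_def)
  have \<alpha>: "\<bar>lam n * \<gamma> n * \<beta> / E n\<bar> \<le> B" for n
  proof -
    have "lam n * (\<gamma> n * \<beta>) / E n \<le> 2 * 4 / (\<epsilon> / 2)"
      using lam_le[of n] gamma_beta[of n] E_bounds[of n] eps lam_pos[of n] gamma_pos[of n] beta
      by (intro frac_le mult_mono) auto
    then show ?thesis
      using lam_pos[of n] gamma_pos[of n] beta E_pos[of n] by (simp add: B_def mult.assoc)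
  qed
  have lam1: "\<bar>1 - lam n\<bar> \<le> 1" for n using lam_le[of n] lam_pos[of n] by auto
  have \<theta>: "\<bar>(1 - lam n) * \<gamma> n * \<beta> / E n\<bar> \<le> B" for n
  proof -
    have "\<bar>1 - lam n\<bar> * (\<gamma> n * \<beta>) / E n \<le> 1 * 4 / (\<epsilon> / 2)"
      using lam1[of n] gamma_beta[of n] E_bounds[of n] eps gamma_pos[of n] beta
      by (intro frac_le mult_mono) auto
    also have "\<dots> \<le> B" using eps by (simp add: B_def divide_right_mono)
    finally show ?thesis
      using gamma_pos[of n] beta E_pos[of n] by (simp add: abs_mult mult.assoc)
  qed
  have \<eta>: "\<bar>2 * (1 - lam n) / D n\<bar> \<le> B" for n
  proof -
    have "2 * \<bar>1 - lam n\<bar> / D n \<le> 2 * 1 / \<epsilon>"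
      using lam1[of n] D_bounds[of n] eps by (intro frac_le mult_mono) auto
    also have "\<dots> \<le> B" using eps by (simp add: B_def divide_right_mono)
    finally show ?thesis
      unfolding abs_divide abs_mult abs_of_pos[OF D_pos] abs_numeral .
  qed
  have scale: "nm (a *\<^sub>R w) \<le> B * l" if "\<bar>a\<bar> \<le> B" "nm w \<le> l" for a w l
    unfolding nm_scaleR using that B by (intro mult_mono) auto
  define K1 where "K1 = k + B * k + B * k"
  have K1: "0 \<le> K1" using k(1) B by (simp add: K1_def)
  have d: "nm (p (Suc n) - x (Suc n)) \<le> K1 * S n" for n
  proof -
    let ?a = "(lam (Suc n) * \<gamma> (Suc n) * \<beta> / E (Suc n)) *\<^sub>R u (Suc n)"
    let ?b = "(2 * (1 - lam (Suc n)) / D (Suc n)) *\<^sub>R v (Suc n)"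
    have "p (Suc n) - x (Suc n) = r (Suc n) - ?a + ?b" by (simp add: r_def)
    then have "nm (p (Suc n) - x (Suc n)) \<le> nm (r (Suc n)) + nm ?a + nm ?b"
      using nm_triangle[of "r (Suc n) - ?a" ?b] nm_diff_triangle[of "r (Suc n)" ?a] by simp
    also have "\<dots> \<le> k * S n + B * (k * S n) + B * (k * S n)"
      by (intro add_mono k(2) scale \<alpha> \<eta> k(3,4))
    finally show ?thesis by (simp add: K1_def algebra_simps)
  qed
  define K2 where "K2 = B * k + k + K1"
  have K2: "0 \<le> K2" using k(1) B K1 by (simp add: K2_def)
  have zp: "nm (z (Suc n) - p (Suc n)) \<le> K2 * S n" for n
  proof -
    let ?a = "((1 - lam (Suc n)) * \<gamma> (Suc n) * \<beta> / E (Suc n)) *\<^sub>R u (Suc n)"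
    let ?d = "p (Suc n) - x (Suc n)"
    have eq: "z (Suc n) - p (Suc n) = (?a + v (Suc n)) - ?d" by (simp add: z_eq)
    have "nm (z (Suc n) - p (Suc n)) \<le> nm ?a + nm (v (Suc n)) + nm ?d"
      unfolding eq
      using nm_diff_triangle[of "?a + v (Suc n)" ?d] nm_triangle[of ?a "v (Suc n)"] by linarith
    also have "\<dots> \<le> B * (k * S n) + k * S n + K1 * S n"
      by (intro add_mono d scale \<theta> k(3,4))
    finally show ?thesis by (simp add: K2_def algebra_simps)
  qed
  have yp: "nm (y (Suc n) - p (Suc n)) \<le> (k + K1) * S n" for n
  proof -
    have "y (Suc n) - p (Suc n) = u (Suc n) - (p (Suc n) - x (Suc n))" by (simp add: y_eq)
    then have "nm (y (Suc n) - p (Suc n)) \<le> nm (u (Suc n)) + nm (p (Suc n) - x (Suc n))"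
      using nm_diff_triangle by metis
    then show ?thesis using add_mono[OF k(3) d] by (simp add: algebra_simps) (meson order_trans)
  qed
  have step: "nm (x (Suc (Suc n)) - x (Suc n)) \<le> 2 * K2 * S n" for n
  proof -
    have "nm (x (Suc (Suc n)) - x (Suc n)) = lam (Suc n) * nm (z (Suc n) - p (Suc n))"
      using lam_pos[of "Suc n"]
      by (simp add: x_Suc[of "Suc n"] nm_scaleR nm_minus_commute[of "p (Suc n)"])
    also have "\<dots> \<le> 2 * (K2 * S n)"
      using lam_le[of "Suc n"] lam_pos[of "Suc n"] zp by (intro mult_mono) auto
    finally show ?thesis by simp
  qed
  define K3 where "K3 = 1 / \<epsilon> * K2 + \<beta> * (k + K1)"
  have K3: "0 \<le> K3" using K2 K1 k(1) beta eps by (simp add: K3_def)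
  have w: "nm (\<omega> (Suc n)) \<le> K3 * S n" for n
  proof -
    have "nm (\<omega> (Suc n)) \<le> nm ((1 / \<gamma> (Suc n)) *\<^sub>R (z (Suc n) - p (Suc n)))
        + nm (G (y (Suc n)) - G (p (Suc n)))"
      unfolding \<omega>_def by (rule nm_diff_triangle)
    also have "\<dots> \<le> 1 / \<epsilon> * (K2 * S n) + \<beta> * ((k + K1) * S n)"
    proof (rule add_mono)
      show "nm ((1 / \<gamma> (Suc n)) *\<^sub>R (z (Suc n) - p (Suc n))) \<le> 1 / \<epsilon> * (K2 * S n)"
        unfolding nm_scaleR using zp[of n] gamma[of "Suc n"] eps
        by (intro mult_mono) (auto simp: frac_le)
      show "nm (G (y (Suc n)) - G (p (Suc n))) \<le> \<beta> * ((k + K1) * S n)"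
        using order_trans[OF G_lipschitz mult_left_mono[OF yp]] beta by simp
    qed
    finally show ?thesis by (simp add: K3_def algebra_simps)
  qed
  define K where "K = K1 + 2 * K2 + K3"
  have "K1 * S n \<le> K * S n" "2 * K2 * S n \<le> K * S n" "K3 * S n \<le> K * S n" for n
    using K1 K2 K3 S_nonneg[of n] by (auto simp: K_def intro!: mult_right_mono)
  then show thesis
    using K1 K2 K3 order_trans[OF d] order_trans[OF step] order_trans[OF w]
    by (intro that[of K]) (auto simp: K_def)
qed

section \<open>Asymptotic behaviour of a run\<close>

lemma L_tendsto_zero:
  assumes "xs \<in> Z"
  shows "L \<longlonglongrightarrow> 0"
    and "convergent (\<lambda>n. (nm (x (Suc n) - xs))\<^sup>2)"
    and "(nm (x (Suc n) - xs))\<^sup>2 \<le> (nm (x (Suc 0) - xs))\<^sup>2 + (1 - \<epsilon>) * L 0"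
proof -
  \<comment> \<open>A Lyapunov function: each step lowers it by at least
    \<open>\<epsilon> * L (Suc n)\<close>. Being nonnegative, it converges, so its decrements and
    with them \<open>L\<close> tend to 0.\<close>
  define V where "V n = (nm (x (Suc n) - xs))\<^sup>2 + (1 - \<epsilon>) * L n" for n
  have V: "V (Suc n) + \<epsilon> * L (Suc n) \<le> V n" for n
    using descent[OF assms, of n] by (simp add: V_def algebra_simps)
  have V0: "0 \<le> V n" for n using L_nonneg[of n] eps by (simp add: V_def)
  have dec: "decseq V"
  proof (rule decseq_SucI)
    show "V (Suc n) \<le> V n" for n using V[of n] mult_nonneg_nonneg[OF less_imp_le[OF eps(1)] L_nonneg[of "Suc n"]] by linarith
  qed
  obtain l where l: "V \<longlonglongrightarrow> l" using decseq_convergent[OF dec, of 0] V0 by blast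
  have "(\<lambda>n. (V n - V (Suc n)) / \<epsilon>) \<longlonglongrightarrow> (l - l) / \<epsilon>"
    by (intro tendsto_intros l LIMSEQ_Suc) (use eps in simp)
  then have lim: "(\<lambda>n. (V n - V (Suc n)) / \<epsilon>) \<longlonglongrightarrow> 0" by simp
  have "(\<lambda>n. L (Suc n)) \<longlonglongrightarrow> 0"
  proof (rule Lim_null_comparison[OF always_eventually[OF allI] lim])
    show "norm (L (Suc n)) \<le> (V n - V (Suc n)) / \<epsilon>" for n
      using V[of n] L_nonneg[of "Suc n"] eps by (simp add: field_simps)
  qed
  then show L: "L \<longlonglongrightarrow> 0" by (rule LIMSEQ_imp_Suc)
  have "(\<lambda>n. V n - (1 - \<epsilon>) * L n) \<longlonglongrightarrow> l - (1 - \<epsilon>) * 0"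
    by (intro tendsto_intros l L)
  then show "convergent (\<lambda>n. (nm (x (Suc n) - xs))\<^sup>2)"
    by (auto simp: V_def convergent_def)
  have "(nm (x (Suc n) - xs))\<^sup>2 \<le> V n" using L_nonneg[of n] eps by (simp add: V_def)
  also have "\<dots> \<le> V 0" using dec by (simp add: decseq_def)
  finally show "(nm (x (Suc n) - xs))\<^sup>2 \<le> (nm (x (Suc 0) - xs))\<^sup>2 + (1 - \<epsilon>) * L 0"
    by (simp add: V_def)
qed

lemma residuals_tendsto_zero:
  assumes "Z \<noteq> {}"
  shows "(\<lambda>n. p (Suc n) - x (Suc n)) \<longlonglongrightarrow> 0" and "(\<lambda>n. M (\<omega> (Suc n))) \<longlonglongrightarrow> 0"
proof -
  obtain K where K: "0 \<le> K" "\<And>n. nm (p (Suc n) - x (Suc n)) \<le> K * S n"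
    "\<And>n. nm (\<omega> (Suc n)) \<le> K * S n" by (rule increments_le_S) blast
  have L: "L \<longlonglongrightarrow> 0" using L_tendsto_zero(1) assms by blast
  have "(\<lambda>n. K * S n) \<longlonglongrightarrow> K * (sqrt 0 + sqrt 0)"
    unfolding S_def by (intro tendsto_intros L LIMSEQ_Suc)
  then have S: "(\<lambda>n. K * S n) \<longlonglongrightarrow> 0" by simp
  show "(\<lambda>n. p (Suc n) - x (Suc n)) \<longlonglongrightarrow> 0"
    by (rule tendsto_zero_nm, rule Lim_null_comparison[OF _ S]) (simp add: K)
  show "(\<lambda>n. M (\<omega> (Suc n))) \<longlonglongrightarrow> 0"
    by (rule M.tendsto_zero, rule tendsto_zero_nm, rule Lim_null_comparison[OF _ S]) (simp add: K)
qed

text \<open>Along the subsequence \<open>p\<close> has the same limit as \<open>x\<close>, and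
  \<open>M (\<omega> n)\<close> is a vanishing element of \<open>T (p n)\<close>, so closedness of
  the graph applies.\<close>

lemma subsequential_limit_is_zero:
  assumes "Z \<noteq> {}" and \<rho>: "strict_mono \<rho>" and lim: "(\<lambda>n. x (Suc (\<rho> n))) \<longlonglongrightarrow> a"
  shows "a \<in> Z"
proof (rule zero_if_approximate_zeros)
  have "(\<lambda>n. p (Suc (\<rho> n)) - x (Suc (\<rho> n)) + x (Suc (\<rho> n))) \<longlonglongrightarrow> 0 + a"
    using LIMSEQ_subseq_LIMSEQ[OF residuals_tendsto_zero(1)[OF assms(1)] \<rho>] lim
    by (intro tendsto_add) (simp_all add: o_def)
  then show "(\<lambda>n. p (Suc (\<rho> n))) \<longlonglongrightarrow> a" by simp
  show "(\<lambda>n. M (\<omega> (Suc (\<rho> n)))) \<longlonglongrightarrow> 0"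
    using LIMSEQ_subseq_LIMSEQ[OF residuals_tendsto_zero(2)[OF assms(1)] \<rho>] by (simp add: o_def)
  show "M (\<omega> (Suc (\<rho> n))) \<in> T (p (Suc (\<rho> n)))" for n by (rule M_omega_mem)
qed

text \<open>A cluster point is a zero, and the squared distance of the iterates to a zero converges, so
  the distance to a cluster point tends to 0.\<close>

lemma finite_dimensional_convergence:
  fixes B :: "'a set"
  assumes "Z \<noteq> {}" and B: "finite B" "span B = UNIV"
  obtains xs where "xs \<in> Z" "(\<lambda>n. p (Suc n)) \<longlonglongrightarrow> xs"
proof -
  obtain x0 where x0: "x0 \<in> Z" using assms(1) by blast
  obtain c where c: "c > 0" "\<And>w. norm w \<le> c * nm w" by (rule norm_le_nm) blast
  define b where "b = sqrt ((nm (x (Suc 0) - x0))\<^sup>2 + (1 - \<epsilon>) * L 0)"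
  have "norm (x (Suc n) - x0) \<le> c * b" for n
    using real_le_rsqrt[OF L_tendsto_zero(3)[OF x0, of n]] c
    by (metis b_def mult_left_mono order_trans less_imp_le)
  then have "norm (x (Suc n)) \<le> c * b + norm x0" for n
    using norm_triangle_ineq[of "x (Suc n) - x0" x0] by (metis add_right_mono diff_add_cancel order_trans)
  then have "bounded (range (\<lambda>n. x (Suc n)))" by (auto intro: boundedI)
  then obtain xs \<rho> where \<rho>: "strict_mono (\<rho> :: nat \<Rightarrow> nat)" and "((\<lambda>n. x (Suc n)) \<circ> \<rho>) \<longlonglongrightarrow> xs"
    using bounded_seq_convergent_subseq[OF B] by metis
  then have lim: "(\<lambda>n. x (Suc (\<rho> n))) \<longlonglongrightarrow> xs" by (simp add: o_def)
  have xs: "xs \<in> Z" by (rule subsequential_limit_is_zero[OF assms(1) \<rho> lim])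
  obtain l where l: "(\<lambda>n. (nm (x (Suc n) - xs))\<^sup>2) \<longlonglongrightarrow> l"
    using L_tendsto_zero(2)[OF xs] by (auto simp: convergent_def)
  have "(\<lambda>n. ip (x (Suc (\<rho> n)) - xs) (x (Suc (\<rho> n)) - xs)) \<longlonglongrightarrow> ip (xs - xs) (xs - xs)"
    by (intro ip.tendsto tendsto_intros lim)
  then have "(\<lambda>n. (nm (x (Suc (\<rho> n)) - xs))\<^sup>2) \<longlonglongrightarrow> 0"
    by (simp add: nm_sq ip.zero_left)
  then have "l = 0"
    using LIMSEQ_subseq_LIMSEQ[OF l \<rho>] unfolding o_def by (rule LIMSEQ_unique[rotated])
  then have "(\<lambda>n. sqrt ((nm (x (Suc n) - xs))\<^sup>2)) \<longlonglongrightarrow> sqrt 0"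
    using l by (intro tendsto_real_sqrt) simp
  then have "(\<lambda>n. x (Suc n) - xs) \<longlonglongrightarrow> 0" by (intro tendsto_zero_nm) simp
  then have "(\<lambda>n. (p (Suc n) - x (Suc n)) + (x (Suc n) - xs)) \<longlonglongrightarrow> 0 + 0"
    by (intro tendsto_add residuals_tendsto_zero(1) assms(1))
  then have "(\<lambda>n. p (Suc n)) \<longlonglongrightarrow> xs" by (simp add: LIM_zero_iff)
  with xs show thesis by (rule that)
qed

section \<open>Distance to the zero set and the error bound\<close>

definition distZ :: "'a \<Rightarrow> real" where
  "distZ w = (INF y\<in>Z. nm (w - y))"

lemma distZ_le: "xs \<in> Z \<Longrightarrow> distZ w \<le> nm (w - xs)"
  unfolding distZ_def by (rule cINF_lower) (auto intro: bdd_belowI2[of _ 0])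

lemma distZ_greatest: "Z \<noteq> {} \<Longrightarrow> (\<And>xs. xs \<in> Z \<Longrightarrow> a \<le> nm (w - xs)) \<Longrightarrow> a \<le> distZ w"
  unfolding distZ_def by (rule cINF_greatest)

lemma distZ_nonneg: "Z \<noteq> {} \<Longrightarrow> 0 \<le> distZ w"
  by (rule distZ_greatest) simp_all

lemma distZ_triangle:
  assumes "Z \<noteq> {}"
  shows "distZ w \<le> nm (w - w') + distZ w'"
proof -
  have "distZ w - nm (w - w') \<le> distZ w'"
  proof (rule distZ_greatest[OF assms])
    fix xs assume "xs \<in> Z"
    then have "distZ w \<le> nm (w - xs)" by (rule distZ_le)
    also have "\<dots> \<le> nm (w - w') + nm (w' - xs)"
      using nm_triangle[of "w - w'" "w' - xs"] by simp
    finally show "distZ w - nm (w - w') \<le> nm (w' - xs)" by simp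
  qed
  then show ?thesis by simp
qed

text \<open>On the left \<open>distZ\<close> is below the distance to any zero, so
  \<open>descent\<close> bounds a quantity independent of \<open>xs\<close>; the infimum over
  \<open>xs\<close> is then taken on the right.\<close>

lemma distZ_descent:
  assumes "Z \<noteq> {}"
  shows "(distZ (x (Suc (Suc n))))\<^sup>2 + L (Suc n) \<le> (distZ (x (Suc n)))\<^sup>2 + (1 - \<epsilon>) * L n"
proof -
  \<comment> \<open>The infimum is one of norms, not of squares, so a root is taken first;
    \<open>max 0 a\<close> keeps its argument nonnegative.\<close>
  define a where "a = (distZ (x (Suc (Suc n))))\<^sup>2 + L (Suc n) - (1 - \<epsilon>) * L n"
  have "sqrt (max 0 a) \<le> distZ (x (Suc n))"
  proof (rule distZ_greatest[OF assms])
    fix xs assume xs: "xs \<in> Z"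
    have "(distZ (x (Suc (Suc n))))\<^sup>2 \<le> (nm (x (Suc (Suc n)) - xs))\<^sup>2"
      by (intro power_mono distZ_le xs distZ_nonneg assms)
    then have "max 0 a \<le> (nm (x (Suc n) - xs))\<^sup>2"
      using descent[OF xs, of n] by (simp add: a_def)
    then show "sqrt (max 0 a) \<le> nm (x (Suc n) - xs)" by (intro real_le_lsqrt) simp_all
  qed
  then have "max 0 a \<le> (distZ (x (Suc n)))\<^sup>2" by (rule sqrt_le_D)
  then show ?thesis by (simp add: a_def)
qed

text \<open>Subregularity is applied at \<open>p (Suc n)\<close>, where the small element
  \<open>M (\<omega> (Suc n))\<close> of \<open>T\<close> is known; it eventually lies in
  \<open>V\<close>. The triangle inequality then returns from \<open>p\<close> to \<open>x\<close>,
  at the cost of another multiple of \<open>S n\<close>.\<close>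

lemma error_bound:
  assumes sub: "metrically_subregular_on M T xs 0 U"
    and U: "\<forall>\<^sub>F n in sequentially. p (Suc n) \<in> U"
  obtains K N where "K > 0"
    "\<And>n. N \<le> n \<Longrightarrow> (distZ (x (Suc n)))\<^sup>2 \<le> K * (L (Suc n) + L n)"
proof -
  obtain \<kappa> V where \<kappa>: "0 \<le> \<kappa>" and V: "0 \<in> interior V" and xs: "0 \<in> T xs"
    and bound: "\<And>w. w \<in> U \<Longrightarrow>
      dist_wrt M w (inverse_mapping T 0) \<le> ereal \<kappa> * dist_wrt (inv M) 0 (T w \<inter> V)"
    using sub by (auto simp: metrically_subregular_on_def)
  have Z: "inverse_mapping T 0 = Z" by (simp add: inverse_mapping_def zer_def)
  have nonempty: "Z \<noteq> {}" using xs by (auto simp: zer_def)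
  obtain K where K: "0 \<le> K" "\<And>n. nm (p (Suc n) - x (Suc n)) \<le> K * S n"
    "\<And>n. nm (\<omega> (Suc n)) \<le> K * S n" by (rule increments_le_S) blast
  have "\<forall>\<^sub>F n in sequentially. M (\<omega> (Suc n)) \<in> interior V"
    using topological_tendstoD[OF residuals_tendsto_zero(2)[OF nonempty] open_interior V] .
  with U have "\<forall>\<^sub>F n in sequentially. p (Suc n) \<in> U \<and> M (\<omega> (Suc n)) \<in> V"
    by eventually_elim (use interior_subset in blast)
  then obtain N where N: "\<And>n. N \<le> n \<Longrightarrow> p (Suc n) \<in> U \<and> M (\<omega> (Suc n)) \<in> V"
    by (auto simp: eventually_sequentially)
  define K' where "K' = K + \<kappa> * K"
  have "(distZ (x (Suc n)))\<^sup>2 \<le> (2 * K'\<^sup>2 + 1) * (L (Suc n) + L n)" if n: "N \<le> n" for n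
  proof -
    have "ereal (distZ (p (Suc n))) = dist_wrt M (p (Suc n)) Z"
      by (simp add: dist_wrt_nonempty[OF nonempty] distZ_def)
    also have "\<dots> \<le> ereal \<kappa> * dist_wrt (inv M) 0 (T (p (Suc n)) \<inter> V)"
      using bound N[OF n] Z by metis
    also have "\<dots> \<le> ereal \<kappa> * ereal (nm (\<omega> (Suc n)))"
    proof (rule ereal_mult_left_mono)
      \<comment> \<open>\<open>M (\<omega> (Suc n))\<close> competes in the infimum, and its dual
        norm is \<open>nm (\<omega> (Suc n))\<close>.\<close>
      have "dist_wrt (inv M) 0 (T (p (Suc n)) \<inter> V) \<le> ereal (norm_wrt (inv M) (0 - M (\<omega> (Suc n))))"
        unfolding dist_wrt_def using N[OF n] M_omega_mem by (intro INF_lower) auto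
      then show "dist_wrt (inv M) 0 (T (p (Suc n)) \<inter> V) \<le> ereal (nm (\<omega> (Suc n)))"
        by (simp add: norm_wrt_inv flip: M.neg)
    qed (use \<kappa> in simp)
    finally have "distZ (p (Suc n)) \<le> \<kappa> * nm (\<omega> (Suc n))" by simp
    also have "\<dots> \<le> \<kappa> * (K * S n)" by (intro mult_left_mono K \<kappa>)
    finally have "distZ (x (Suc n)) \<le> K * S n + \<kappa> * (K * S n)"
      using distZ_triangle[OF nonempty, of "x (Suc n)" "p (Suc n)"] K(2)[of n]
      by (simp add: nm_minus_commute[of "x (Suc n)"])
    then have "distZ (x (Suc n)) \<le> K' * S n" by (simp add: K'_def algebra_simps)
    then have "(distZ (x (Suc n)))\<^sup>2 \<le> (K' * S n)\<^sup>2"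
      by (intro power_mono distZ_nonneg nonempty)
    also have "\<dots> \<le> K'\<^sup>2 * (2 * (L (Suc n) + L n))"
      unfolding power_mult_distrib by (intro mult_left_mono S_power2_le) simp
    also have "\<dots> \<le> (2 * K'\<^sup>2 + 1) * (L (Suc n) + L n)"
      using L_nonneg[of n] L_nonneg[of "Suc n"] by (simp add: algebra_simps)
    finally show ?thesis .
  qed
  then show thesis
    by (intro that[of "2 * K'\<^sup>2 + 1" N]) (auto intro: add_nonneg_pos)
qed

lemma distZ_zero_if_stationary:
  assumes "Z \<noteq> {}" and "L (Suc n) = 0" "L n = 0"
  shows "distZ (x (Suc n)) = 0"
proof -
  obtain K where K: "\<And>n. nm (p (Suc n) - x (Suc n)) \<le> K * S n" "\<And>n. nm (\<omega> (Suc n)) \<le> K * S n"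
    by (rule increments_le_S) blast
  have S: "S n = 0" by (simp add: S_def assms)
  obtain c where c: "c > 0" "\<And>w. norm w \<le> c * nm w" by (rule norm_le_nm) blast
  have zero: "w = 0" if "nm w \<le> 0" for w
    using c(2)[of w] that nm_nonneg[of w] by simp
  have "p (Suc n) - x (Suc n) = 0" "\<omega> (Suc n) = 0"
    using K[of n] unfolding S by (intro zero; simp)+
  then have "0 \<in> T (x (Suc n))" using M_omega_mem[of "Suc n"] by (simp add: M.zero)
  then have "distZ (x (Suc n)) \<le> nm 0" using distZ_le[of "x (Suc n)" "x (Suc n)"] by (simp add: zer_def)
  also have "nm 0 = 0" by (simp add: norm_wrt_def)
  finally show ?thesis using distZ_nonneg[OF assms(1)] order_antisym by blast
qed

section \<open>Linear convergence of distances and iterates\<close>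

lemma linear_convergence:
  assumes nonempty: "Z \<noteq> {}"
    and sub: "metrically_subregular_on M T xs 0 U" "\<forall>\<^sub>F n in sequentially. p (Suc n) \<in> U"
  obtains q \<delta> a c where "0 < q" "q < 1" "0 < \<delta>" "\<delta> < 1" "a \<in> Z" "0 < c" "x \<longlonglongrightarrow> a"
    "\<And>n. (distZ (x (Suc (Suc n))))\<^sup>2 + (1 - \<delta>) * L (Suc n)
      \<le> q * ((distZ (x (Suc n)))\<^sup>2 + (1 - \<delta>) * L n)"
    "\<And>n. (norm (x (Suc n) - a))\<^sup>2 \<le> c * q ^ Suc n"
proof -
  obtain K N where K: "K > 0"
      "\<And>n. N \<le> n \<Longrightarrow> (distZ (x (Suc n)))\<^sup>2 \<le> K * (L (Suc n) + L n)"
    by (rule error_bound[OF sub]) blast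
  obtain q \<delta> where q: "0 < q" "q < 1" and \<delta>: "0 < \<delta>" "\<delta> < 1"
    and rate: "\<And>n. (distZ (x (Suc (Suc n))))\<^sup>2 + (1 - \<delta>) * L (Suc n)
      \<le> q * ((distZ (x (Suc n)))\<^sup>2 + (1 - \<delta>) * L n)"
    using geometric_lyapunov_contraction[of \<epsilon> "\<lambda>n. (distZ (x n))\<^sup>2" L K N]
      eps L_nonneg distZ_descent[OF nonempty] K distZ_zero_if_stationary[OF nonempty]
    by (metis (no_types, lifting) zero_le_power2 zero_power2)
  define W where "W n = (distZ (x (Suc n)))\<^sup>2 + (1 - \<delta>) * L n" for n
  have W: "W n \<le> W 0 * q ^ n" for n
  proof (induction n)
    case (Suc n)
    have "W (Suc n) \<le> q * W n" using rate[of n] by (simp add: W_def)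
    also have "\<dots> \<le> q * (W 0 * q ^ n)" using Suc q by (intro mult_left_mono) auto
    finally show ?case by (simp add: algebra_simps)
  qed simp
  \<comment> \<open>\<open>W\<close> controls \<open>L\<close> itself, whereas increments scale like
    its square root; the iterates therefore contract at rate \<open>sqrt q\<close>, which squaring
    turns back into \<open>q\<close>.\<close>
  define \<rho> where "\<rho> = sqrt q"
  have \<rho>: "0 < \<rho>" "\<rho> < 1" "\<rho>\<^sup>2 = q" using q by (auto simp: \<rho>_def)
  define b where "b = sqrt (W 0 / (1 - \<delta>))"
  have sqrtL: "sqrt (L n) \<le> b * \<rho> ^ n" for n
  proof -
    have "(1 - \<delta>) * L n \<le> W n" by (simp add: W_def)
    then have "L n \<le> W 0 / (1 - \<delta>) * q ^ n" using W[of n] \<delta> by (simp add: field_simps)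
    then have "sqrt (L n) \<le> sqrt (W 0 / (1 - \<delta>) * q ^ n)" by simp
    then show ?thesis by (simp only: real_sqrt_mult real_sqrt_power b_def \<rho>_def)
  qed
  have b: "0 \<le> b" using order_trans[OF real_sqrt_ge_zero[OF L_nonneg] sqrtL[of 0]] by simp
  obtain k where k: "0 \<le> k" "\<And>n. nm (x (Suc (Suc n)) - x (Suc n)) \<le> k * S n"
    by (rule increments_le_S) blast
  obtain c where c: "c > 0" "\<And>w. norm w \<le> c * nm w" by (rule norm_le_nm) blast
  have "norm (x (Suc (Suc n)) - x (Suc n)) \<le> c * (k * (2 * b)) * \<rho> ^ n" for n
  proof -
    have "b * \<rho> ^ Suc n \<le> b * \<rho> ^ n"
      using \<rho> b by (intro mult_left_mono power_decreasing) auto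
    then have "S n \<le> 2 * b * \<rho> ^ n" using sqrtL[of n] sqrtL[of "Suc n"] by (simp add: S_def)
    then have "c * (k * S n) \<le> c * (k * (2 * b * \<rho> ^ n))"
      using c k by (intro mult_left_mono) auto
    moreover have "norm (x (Suc (Suc n)) - x (Suc n)) \<le> c * (k * S n)"
      using order_trans[OF c(2) mult_left_mono[OF k(2)]] c(1) by simp
    ultimately show ?thesis by (simp add: mult.assoc)
  qed
  then obtain a where a: "(\<lambda>n. x (Suc n)) \<longlonglongrightarrow> a"
      "\<And>n. norm (x (Suc n) - a) \<le> c * (k * (2 * b)) / (1 - \<rho>) * \<rho> ^ n"
    using geometric_increments_converge[of \<rho> "\<lambda>n. x (Suc n)"] \<rho> by (metis less_imp_le)
  define d where "d = c * (k * (2 * b)) / (1 - \<rho>)"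
  \<comment> \<open>Division by \<open>q\<close> accounts for the shift from \<open>q ^ n\<close> to
    \<open>q ^ Suc n\<close>, and the added 1 makes the constant positive even when \<open>d\<close>
    is 0.\<close>
  have "(norm (x (Suc n) - a))\<^sup>2 \<le> (d\<^sup>2 / q + 1) * q ^ Suc n" for n
  proof -
    have "(norm (x (Suc n) - a))\<^sup>2 \<le> (d * \<rho> ^ n)\<^sup>2"
      using a(2)[of n] by (intro power_mono) (auto simp: d_def)
    also have "\<dots> = d\<^sup>2 * q ^ n"
      unfolding power_mult_distrib \<rho>(3)[symmetric] by (simp add: mult.commute flip: power_mult)
    also have "\<dots> = d\<^sup>2 / q * q ^ Suc n" using q by simp
    also have "\<dots> \<le> (d\<^sup>2 / q + 1) * q ^ Suc n" using q by (intro mult_right_mono) auto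
    finally show ?thesis .
  qed
  moreover have "0 < d\<^sup>2 / q + 1" using q by (intro add_nonneg_pos) auto
  moreover have "x \<longlonglongrightarrow> a" using a(1) by (rule LIMSEQ_imp_Suc)
  moreover have "a \<in> Z"
    using subsequential_limit_is_zero[OF nonempty strict_mono_id] a(1) by simp
  ultimately show thesis using that q \<delta> rate by blast
qed

end

section \<open>Assembly of the two cases\<close>

theorem theorem2:
  fixes M C :: "'a::{real_inner, complete_space} \<Rightarrow> 'a"
    and A :: "'a \<Rightarrow> 'a set"
    and \<beta> \<epsilon> :: real
    and \<zeta> \<gamma> lam L :: "nat \<Rightarrow> real"
    and x u v y z p :: "nat \<Rightarrow> 'a"
  assumes "bounded_linear M" and "self_adjoint M" and "strongly_positive M"
    and "\<beta> > 0"
    and "maximally_monotone A"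
    and "cocoercive_wrt M (1 / \<beta>) C"
    and "zer (sum_mapping A C) \<noteq> {}"
    and "0 < \<epsilon>" and "\<epsilon> < min 1 (4 / (3 + \<beta>))"
    and "\<And>n. 0 \<le> \<zeta> n \<and> \<zeta> n \<le> 1 - \<epsilon>"
    and "\<And>n. \<epsilon> \<le> \<gamma> n \<and> \<gamma> n \<le> (4 - 3 * \<epsilon>) / \<beta>"
    and "\<And>n. \<epsilon> \<le> lam n \<and> lam n \<le> 2 - \<gamma> n * \<beta> / 2 - \<epsilon> / 2"
    and "\<And>xs. xs \<in> zer (sum_mapping A C) \<Longrightarrow> metrically_subregular M (sum_mapping A C) xs 0"
    and "(\<exists>B :: 'a set. finite B \<and> span B = UNIV) \<or>
      (\<forall>xs \<in> zer (sum_mapping A C). metrically_subregular_on M (sum_mapping A C) xs 0 UNIV)"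
    and "fb_deviations M A C \<beta> \<zeta> \<gamma> lam x u v y z p L"
  shows "\<exists>q::real. 0 \<le> q \<and> q < 1 \<and>
    (\<exists>\<delta>::real. 0 < \<delta> \<and> \<delta> < 1 \<and>
      (\<forall>n\<ge>1. (dist_wrt M (x (n + 1)) (zer (sum_mapping A C)))\<^sup>2 + ereal ((1 - \<delta>) * L n)
        \<le> ereal q * ((dist_wrt M (x n) (zer (sum_mapping A C)))\<^sup>2 + ereal ((1 - \<delta>) * L (n - 1))))) \<and>
    (\<exists>xs \<in> zer (sum_mapping A C). \<exists>c::real. c > 0 \<and>
      (\<forall>n\<ge>1. (norm (x n - xs))\<^sup>2 \<le> c * q ^ n) \<and> x \<longlonglongrightarrow> xs)"
proof -
  interpret deviated_forward_backward M A C \<beta> \<epsilon> \<zeta> \<gamma> lam L x u v y z p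
    by (intro deviated_forward_backward.intro cocoercive_inclusion.intro
        strongly_positive_operator.intro deviated_forward_backward_axioms.intro
        cocoercive_inclusion_axioms.intro assms(1-6,8,10-12,15)) (use assms(9) in simp)
  note nonempty = assms(7)
  \<comment> \<open>In finite dimension \<open>p\<close> converges to some zero and eventually
    enters its neighborhood; in the other case any zero serves, with the whole space as
    \<open>U\<close>.\<close>
  obtain xs U where "metrically_subregular_on M T xs 0 U" "\<forall>\<^sub>F n in sequentially. p (Suc n) \<in> U"
  proof -
    consider B :: "'a set" where "finite B" "span B = UNIV"
      | "\<forall>xs\<in>Z. metrically_subregular_on M T xs 0 UNIV"
      using assms(14) by blast
    then show thesis
    proof cases
      case 1
      obtain xs where xs: "xs \<in> Z" "(\<lambda>n. p (Suc n)) \<longlonglongrightarrow> xs"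
        by (rule finite_dimensional_convergence[OF nonempty 1]) blast
      obtain U where U: "metrically_subregular_on M T xs 0 U"
        using assms(13)[OF xs(1)] by (auto simp: metrically_subregular_def)
      then have "xs \<in> interior U" by (simp add: metrically_subregular_on_def)
      then have "\<forall>\<^sub>F n in sequentially. p (Suc n) \<in> interior U"
        by (rule topological_tendstoD[OF xs(2) open_interior])
      then have "\<forall>\<^sub>F n in sequentially. p (Suc n) \<in> U"
        by eventually_elim (use interior_subset in blast)
      with U show thesis by (rule that)
    next
      case 2
      then show thesis using nonempty that[of _ UNIV] by auto
    qed
  qed
  then obtain q \<delta> a c where q: "0 < q" "q < 1" and \<delta>: "0 < \<delta>" "\<delta> < 1"
    and a: "a \<in> Z" "0 < c" "x \<longlonglongrightarrow> a"
    and rate: "\<And>n. (distZ (x (Suc (Suc n))))\<^sup>2 + (1 - \<delta>) * L (Suc n)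
      \<le> q * ((distZ (x (Suc n)))\<^sup>2 + (1 - \<delta>) * L n)"
    and bound: "\<And>n. (norm (x (Suc n) - a))\<^sup>2 \<le> c * q ^ Suc n"
    using linear_convergence[OF nonempty] by metis
  have dist: "dist_wrt M w Z = ereal (distZ w)" for w
    by (simp add: dist_wrt_nonempty[OF nonempty] distZ_def)
  have "(dist_wrt M (x (n + 1)) Z)\<^sup>2 + ereal ((1 - \<delta>) * L n)
      \<le> ereal q * ((dist_wrt M (x n) Z)\<^sup>2 + ereal ((1 - \<delta>) * L (n - 1)))" if n: "1 \<le> n" for n
  proof -
    obtain m where "n = Suc m" using n by (cases n) auto
    then show ?thesis using rate[of m] by (simp add: dist power2_eq_square)
  qed
  moreover have "(norm (x n - a))\<^sup>2 \<le> c * q ^ n" if "1 \<le> n" for n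
    using bound[of "n - 1"] that by simp
  ultimately show ?thesis
    using q \<delta> a less_imp_le[OF q(1)] by blast
qed

end
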